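(* Let $q$ be a prime power and $\ell$ a prime with $\ell\nmid q$. For $g\ge0$ let $\mathfrak{Q}(q,\ell,g)$ be the proportion of matrices in $\mathrm{GSp}_{2g}^{(q)}(\mathbb{F}_\ell)$ having $1$ as an eigenvalue, and define \[ \mathcal{E}(q,\ell,g) := \begin{cases} 1-\prod_{j=1}^\infty\left(1+\ell^{-j}\right)^{-1} - \mathfrak{Q}(q,\ell,g) & \text{if } \ell \mid q-1, \\ 1-\prod_{j=1}^\infty\left(1-\ell^{-j}\right) - \mathfrak{Q}(q,\ell,g) & \text{if } \ell \nmid q-1. \end{cases}\] Then \[ \lim_{g\to \infty} \mathfrak{Q}(q,\ell,g) = \begin{cases} 1-\prod_{j=1}^\infty\left(1+\ell^{-j}\right)^{-1} & \text{if } \ell \mid q-1, \\ 1-\prod_{j=1}^\infty\left(1-\ell^{-j}\right) & \text{if } \ell \nmid q-1, \end{cases} \] and moreover the convergence is alternating: $\lim_{g\to\infty}\mathcal{E}(q,\ell,g)=0$ and $(-1)^g\mathcal{E}(q,\ell,g)>0$ for each $g\ge 0$.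
   Context: Let $\Omega=\begin{pmatrix}0&\mathbb{I}_g\\-\mathbb{I}_g&0\end{pmatrix}$ ($2g\times 2g$) and $\mathrm{GSp}_{2g}^{(q)}(\mathbb{F}_\ell)=\{M\in\mathrm{GL}_{2g}(\mathbb{F}_\ell): {}^tM\Omega M=q\Omega\}$, with $q$ read modulo $\ell$. For $g=0$ the set consists of a single matrix without eigenvalue $1$, so $\mathfrak{Q}(q,\ell,0)=0$. *)

theory Defs
  imports
    "HOL-Analysis.Infinite_Products"
    "HOL-Number_Theory.Prime_Powers"
    "Jordan_Normal_Form.Char_Poly"
    "Berlekamp_Zassenhaus.Finite_Field"
begin

(* The field F_l is 'l mod_ring, the integers modulo l = CARD('l), where the
   class prime_card says that CARD('l) is prime. *)

definition Omega_mat :: "nat \<Rightarrow> 'a::field mat" where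
  "Omega_mat g = four_block_mat (0\<^sub>m g g) (1\<^sub>m g) (- 1\<^sub>m g) (0\<^sub>m g g)"

definition GSp :: "nat \<Rightarrow> nat \<Rightarrow> 'a::field mat set" where
  "GSp q g = {M \<in> carrier_mat (2 * g) (2 * g). invertible_mat M \<and>
     transpose_mat M * Omega_mat g * M = of_nat q \<cdot>\<^sub>m Omega_mat g}"

definition eigenvalue_one_proportion :: "'l::prime_card itself \<Rightarrow> nat \<Rightarrow> nat \<Rightarrow> real" where
  "eigenvalue_one_proportion _ q g =
     real (card {M \<in> (GSp q g :: 'l mod_ring mat set). eigenvalue M 1})
       / real (card (GSp q g :: 'l mod_ring mat set))"

(* prodinf starts at index 0, so the factor at j is the one usually indexed j + 1. *)
definition eigenvalue_one_error :: "'l::prime_card itself \<Rightarrow> nat \<Rightarrow> nat \<Rightarrow> real" where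
  "eigenvalue_one_error L q g =
     (if CARD('l) dvd q - 1
      then 1 - (\<Prod>j. inverse (1 + 1 / real CARD('l) ^ Suc j)) - eigenvalue_one_proportion L q g
      else 1 - (\<Prod>j. 1 - 1 / real CARD('l) ^ Suc j) - eigenvalue_one_proportion L q g)"

end

theory Submission
  imports Defs "HOL-Library.Function_Algebras"
    "HOL-Computational_Algebra.Formal_Power_Series"
begin

unbundle no inner_syntax and no vec_syntax

text \<open>Let \<open>M\<close> be uniformly distributed among the similitudes with multiplier \<open>q\<close> of a symplectic space of
  dimension \<open>2g\<close> over the field with \<open>l\<close> elements, let \<open>d\<close> be the dimension of its space of fixed vectors, and let
  \<open>H\<^sub>g(s)\<close> be the mean of \<open>(1 - s)(1 - s l) \<dots> (1 - s l\<^sup>d\<^sup>-\<^sup>1)\<close>. Then \<open>H\<^sub>g(1)\<close> is the probability that \<open>1\<close> is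
  not an eigenvalue. The difference \<open>H\<^sub>g(l s) - H\<^sub>g(s)\<close> is a sum over pairs of a similitude and a nonzero fixed vector \<open>v\<close>.
  The isometries act transitively on nonzero vectors, and the stabilizer of \<open>v\<close> is described by a similitude of a
  symplectic space of dimension \<open>2g - 2\<close>, a vector of that space and a scalar. Counting fixed vectors in these terms gives
  \<open>H\<^sub>g(l s) - H\<^sub>g(s) = - s H\<^sub>g\<^sub>-\<^sub>1(s)\<close> if \<open>q \<noteq> 1\<close> in the field, and
  \<open>H\<^sub>g(l s) - H\<^sub>g(s) = - s H\<^sub>g\<^sub>-\<^sub>1(s) + s\<^sup>2 H\<^sub>g\<^sub>-\<^sub>1(l s)\<close> if \<open>q = 1\<close>. Since \<open>H\<^sub>g\<close> is continuous with
  \<open>H\<^sub>g(0) = 1\<close>, this determines \<open>H\<^sub>g\<close>. It turns out that \<open>H\<^sub>g(1)\<close> is a partial sum of Euler's alternating series for the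
  infinite product in question, whose terms strictly decrease in absolute value.\<close>

section \<open>Similitudes of a finite alternating space\<close>

text \<open>Translation by a preimage carries the kernel onto each nonempty fibre. The map is
  additive only on \<open>A\<close>, because similitudes are linear only on their carrier.\<close>

lemma card_kernel_image:
  fixes f :: "'a::ab_group_add \<Rightarrow> 'b::ab_group_add"
  assumes fin: "finite A" and diff: "\<And>x y. x \<in> A \<Longrightarrow> y \<in> A \<Longrightarrow> x - y \<in> A"
    and add: "\<And>x y. x \<in> A \<Longrightarrow> y \<in> A \<Longrightarrow> x + y \<in> A"
    and hom: "\<And>x y. x \<in> A \<Longrightarrow> y \<in> A \<Longrightarrow> f (x + y) = f x + f y"
  shows "card A = card {x \<in> A. f x = 0} * card (f ` A)"
proof -
  have fib: "card {x \<in> A. f x = z} = card {x \<in> A. f x = 0}" if z: "z \<in> f ` A" for z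
  proof -
    obtain a where a: "a \<in> A" "z = f a" using z by auto
    have fd: "f (x - a) = f x - z" if "x \<in> A" for x
      using hom[OF diff[OF that a(1)] a(1)] a(2) by simp
    have fa: "f (x + a) = f x + z" if "x \<in> A" for x
      using hom[OF that a(1)] a(2) by simp
    have "bij_betw (\<lambda>x. x + a) {x \<in> A. f x = 0} {x \<in> A. f x = z}"
    proof (rule bij_betw_byWitness[where f' = "\<lambda>x. x - a"])
      show "(\<lambda>x. x + a) ` {x \<in> A. f x = 0} \<subseteq> {x \<in> A. f x = z}"
        using add a(1) fa by force
      show "(\<lambda>x. x - a) ` {x \<in> A. f x = z} \<subseteq> {x \<in> A. f x = 0}"
        using diff a(1) fd by force
    qed simp_all
    thus ?thesis by (rule bij_betw_same_card[symmetric])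
  qed
  have "card A = (\<Sum>z\<in>f ` A. card {x \<in> A. f x = z})"
    using sum.image_gen[OF fin, of "\<lambda>_. 1 :: nat" f] by simp
  also have "\<dots> = card {x \<in> A. f x = 0} * card (f ` A)"
    using fib by simp
  finally show ?thesis .
qed

text \<open>The ambient space is a type, and the spaces of interest are subspaces \<open>W\<close>
  of it. An induction on the dimension can thus pass to a smaller subspace without changing the
  type.\<close>

locale alternating_form = vector_space scale
  for scale :: "'f::{field,finite} \<Rightarrow> 'v::ab_group_add \<Rightarrow> 'v" (infixr \<open>\<star>\<close> 75) +
  fixes B :: "'v \<Rightarrow> 'v \<Rightarrow> 'f"
  assumes form_add_left [simp]: "B (x + y) z = B x z + B y z"
    and form_add_right [simp]: "B z (x + y) = B z x + B z y"
    and form_scale_left [simp]: "B (a \<star> x) y = a * B x y"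
    and form_scale_right [simp]: "B x (a \<star> y) = a * B x y"
    and form_self [simp]: "B x x = 0"
begin

lemma form_swap: "B y x = - B x y"
proof -
  have "0 = B (x + y) (x + y)" by simp
  also have "\<dots> = B x y + B y x" by (simp only: form_add_left form_add_right) simp
  finally show ?thesis by (simp add: eq_neg_iff_add_eq_0 add.commute)
qed

lemma form_zero [simp]: "B 0 x = 0" "B x 0 = 0"
  using form_scale_left[of 0 0 x] form_scale_right[of x 0 0] by simp_all

lemma form_minus [simp]: "B (- x) y = - B x y" "B y (- x) = - B y x"
  using form_scale_left[of "-1" x y] form_scale_right[of y "-1" x] by simp_all

lemma form_diff [simp]: "B (x - y) z = B x z - B y z" "B z (x - y) = B z x - B z y"
  using form_add_left[of x "- y" z] form_add_right[of z x "- y"] by simp_all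

definition nondegenerate :: "'v set \<Rightarrow> bool" where
  "nondegenerate W \<longleftrightarrow> finite W \<and> subspace W \<and> (\<forall>x\<in>W. x \<noteq> 0 \<longrightarrow> (\<exists>y\<in>W. B x y \<noteq> 0))"

definition linear_on :: "'v set \<Rightarrow> ('v \<Rightarrow> 'v) \<Rightarrow> bool" where
  "linear_on W f \<longleftrightarrow> (\<forall>x\<in>W. \<forall>y\<in>W. f (x + y) = f x + f y) \<and> (\<forall>a. \<forall>x\<in>W. f (a \<star> x) = a \<star> f x)"

text \<open>Extensionality makes each map on \<open>W\<close> occur exactly once, so cardinalities
  count maps. For \<open>k \<noteq> 0\<close> and nondegenerate \<open>W\<close>, injectivity
  follows from the form.\<close>

definition similitudes :: "'v set \<Rightarrow> 'f \<Rightarrow> ('v \<Rightarrow> 'v) set" where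
  "similitudes W k = {f \<in> W \<rightarrow>\<^sub>E W. linear_on W f \<and> (\<forall>x\<in>W. \<forall>y\<in>W. B (f x) (f y) = k * B x y)}"

definition fixed :: "'v set \<Rightarrow> ('v \<Rightarrow> 'v) \<Rightarrow> 'v set" where
  "fixed W f = {x \<in> W. f x = x}"

lemma hyperbolic_partner:
  assumes "nondegenerate W" "v \<in> W" "v \<noteq> 0"
  obtains w where "w \<in> W" "B v w = 1"
proof -
  obtain y where y: "y \<in> W" "B v y \<noteq> 0" using assms unfolding nondegenerate_def by blast
  have "inverse (B v y) \<star> y \<in> W" using y assms by (auto simp: nondegenerate_def subspace_scale)
  moreover have "B v (inverse (B v y) \<star> y) = 1" using y by simp
  ultimately show ?thesis by (rule that)
qed

lemma card_subspace_functional: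
  assumes "finite U" "subspace U" "u \<in> U" "B b u \<noteq> 0"
  shows "card U = card {y \<in> U. B b y = 0} * CARD('f)"
proof -
  have "a \<in> B b ` U" for a
  proof -
    have "B b ((a / B b u) \<star> u) = a" using assms by simp
    moreover have "(a / B b u) \<star> u \<in> U" using assms by (simp add: subspace_scale)
    ultimately show ?thesis by (metis image_eqI)
  qed
  hence "B b ` U = UNIV" by auto
  thus ?thesis
    using card_kernel_image[of U "B b"] assms by (simp add: subspace_add subspace_diff)
qed

text \<open>Cardinalities stand in for dimensions, and no basis is chosen. Induction treats a
  hyperplane \<open>U0\<close> of \<open>U\<close>; going from \<open>U0\<close> to \<open>U\<close>
  multiplies the first factor by \<open>CARD('f)\<close> and adds one independent equation to the
  orthogonal complement, which divides the second factor by \<open>CARD('f)\<close>.\<close>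

lemma card_subspace_orth:
  assumes W: "nondegenerate W" and U: "subspace U" "U \<subseteq> W"
  shows "card U * card {b \<in> W. \<forall>u\<in>U. B b u = 0} = card W \<and> (\<exists>d. card U = CARD('f) ^ d)"
  using U
proof (induction "card U" arbitrary: U rule: less_induct)
  case less
  have finW: "finite W" and subW: "subspace W" using W by (auto simp: nondegenerate_def)
  have finU: "finite U" using finW less.prems(2) finite_subset by blast
  show ?case
  proof (cases "U = {0}")
    case True
    thus ?thesis by (auto intro: exI[of _ 0])
  next
    case False
    then obtain u where u: "u \<in> U" "u \<noteq> 0" using subspace_0[OF less.prems(1)] by blast
    obtain w where w: "w \<in> W" "B u w = 1" using hyperbolic_partner[OF W, of u] u less.prems by blast
    have wu: "B w u = -1" using form_swap[of w u] w by simp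
    define U0 where "U0 = {y \<in> U. B w y = 0}"
    have c0: "card U = card U0 * CARD('f)"
      unfolding U0_def using card_subspace_functional[OF finU less.prems(1) u(1)] wu by simp
    have sub0: "subspace U0" using less.prems(1)
      by (auto simp: U0_def subspace_def)
    have "u \<notin> U0" "U0 \<subseteq> U" using wu by (auto simp: U0_def)
    hence lt: "card U0 < card U" using finU u by (metis psubset_card_mono psubsetI)
    from less.hyps[OF lt sub0] \<open>U0 \<subseteq> U\<close> less.prems obtain d where
      IH: "card U0 * card {b \<in> W. \<forall>u\<in>U0. B b u = 0} = card W" "card U0 = CARD('f) ^ d" by blast
    define P0 where "P0 = {b \<in> W. \<forall>u\<in>U0. B b u = 0}"
    have finP: "finite P0" and subP: "subspace P0" using finW subW by (auto simp: P0_def subspace_def)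
    have wP: "w \<in> P0" using w by (auto simp: P0_def U0_def)
    \<comment> \<open>\<open>w\<close> lies in \<open>P0\<close> and is not orthogonal to
      \<open>u\<close>, so the new equation is independent of those from \<open>U0\<close>.\<close>
    have "card P0 = card {b \<in> P0. B u b = 0} * CARD('f)"
      by (rule card_subspace_functional[OF finP subP wP]) (use w in simp)
    moreover have "{b \<in> P0. B u b = 0} = {b \<in> W. \<forall>u\<in>U. B b u = 0}" 
    proof (intro Set.set_eqI iffI)
      fix b assume b: "b \<in> {b \<in> P0. B u b = 0}"
      have "B b x = 0" if "x \<in> U" for x
      proof -
        \<comment> \<open>As \<open>B w u = -1\<close>, this multiple of \<open>u\<close> moves
          \<open>x\<close> into the hyperplane \<open>U0\<close>.\<close>
        have "x + B w x \<star> u \<in> U0"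
          using that u less.prems(1) wu by (auto simp: U0_def subspace_add subspace_scale)
        hence "B b (x + B w x \<star> u) = 0" using b unfolding P0_def by blast
        moreover have "B b u = 0" using b form_swap[of b u] by simp
        ultimately show ?thesis by simp
      qed
      thus "b \<in> {b \<in> W. \<forall>u\<in>U. B b u = 0}" using b by (auto simp: P0_def)
    next
      fix b assume "b \<in> {b \<in> W. \<forall>u\<in>U. B b u = 0}"
      thus "b \<in> {b \<in> P0. B u b = 0}" using u form_swap[of b u] \<open>U0 \<subseteq> U\<close> by (auto simp: P0_def)
    qed
    ultimately have "card P0 = card {b \<in> W. \<forall>u\<in>U. B b u = 0} * CARD('f)" by simp
    hence "card U * card {b \<in> W. \<forall>u\<in>U. B b u = 0} = card W"
      using IH(1) c0 unfolding P0_def[symmetric] by (simp add: mult_ac)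
    moreover have "card U = CARD('f) ^ Suc d" using c0 IH(2) by simp
    ultimately show ?thesis by blast
  qed
qed

section \<open>Similitudes and the transitivity of the isometries\<close>

lemma finite_similitudes: "finite W \<Longrightarrow> finite (similitudes W k)"
  by (rule finite_subset[of _ "W \<rightarrow>\<^sub>E W"]) (auto simp: similitudes_def intro: finite_PiE)

lemma similitudesD:
  assumes "f \<in> similitudes W k"
  shows "x \<in> W \<Longrightarrow> f x \<in> W" "x \<in> W \<Longrightarrow> y \<in> W \<Longrightarrow> f (x + y) = f x + f y"
    "x \<in> W \<Longrightarrow> f (a \<star> x) = a \<star> f x" "x \<in> W \<Longrightarrow> y \<in> W \<Longrightarrow> B (f x) (f y) = k * B x y"
    "f \<in> W \<rightarrow>\<^sub>E W" "f \<in> extensional W"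
  using assms by (auto simp: similitudes_def linear_on_def PiE_def)

lemma subspace_fixed:
  assumes "subspace W" "f \<in> similitudes W k"
  shows "subspace (fixed W f)"
  using assms similitudesD[OF assms(2)] similitudesD(3)[OF assms(2), of 0 0]
  by (auto simp: subspace_def fixed_def)

lemma similitudes_restrictI:
  assumes "subspace W" "\<And>x. x \<in> W \<Longrightarrow> f x \<in> W"
    and "\<And>x y. x \<in> W \<Longrightarrow> y \<in> W \<Longrightarrow> f (x + y) = f x + f y"
    and "\<And>a x. x \<in> W \<Longrightarrow> f (a \<star> x) = a \<star> f x"
    and "\<And>x y. x \<in> W \<Longrightarrow> y \<in> W \<Longrightarrow> B (f x) (f y) = k * B x y"
  shows "restrict f W \<in> similitudes W k"
  using assms by (auto simp: similitudes_def linear_on_def subspace_add subspace_scale)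

lemma compose_similitudes:
  assumes "subspace W" "S \<in> similitudes W a" "M \<in> similitudes W b"
  shows "restrict (\<lambda>x. S (M x)) W \<in> similitudes W (a * b)"
  using assms(1) similitudesD(1-4)[OF assms(2)] similitudesD(1-4)[OF assms(3)]
  by (intro similitudes_restrictI) auto

text \<open>The difference of two points with equal image would be orthogonal to all of
  \<open>W\<close>.\<close>

lemma inj_on_similitude:
  assumes W: "nondegenerate W" and M: "M \<in> similitudes W k" and k: "k \<noteq> 0"
  shows "inj_on M W"
proof (rule inj_onI, rule ccontr)
  fix x y assume xy: "x \<in> W" "y \<in> W" "M x = M y" "x \<noteq> y"
  have "x - y \<in> W" using W xy by (simp add: nondegenerate_def subspace_diff)
  moreover have "x - y \<noteq> 0" using xy by simp
  ultimately obtain z where z: "z \<in> W" "B (x - y) z \<noteq> 0" using W by (auto simp: nondegenerate_def simp del: form_diff)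
  have "k * B x z = k * B y z" using similitudesD(4)[OF M] xy z by metis
  thus False using z k by simp
qed

lemma transvection_similitude:
  assumes W: "subspace W" and a: "a \<in> W"
  shows "restrict (\<lambda>x. x + (c * B x a) \<star> a) W \<in> similitudes W 1"
proof (rule similitudes_restrictI[OF W])
  fix x y :: 'v
  show "B (x + (c * B x a) \<star> a) (y + (c * B y a) \<star> a) = 1 * B x y"
    using form_swap[of a y] by (simp add: algebra_simps)
qed (use W a in \<open>auto simp: subspace_add subspace_scale scale_left_distrib scale_right_distrib algebra_simps\<close>)

text \<open>A transvection along \<open>y - x\<close> takes \<open>x\<close> to \<open>y\<close>
  when \<open>B x y \<noteq> 0\<close>. In general two such steps pass through a vector
  \<open>z\<close> that is orthogonal to neither end.\<close>

lemma isometries_transitive: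
  assumes W: "nondegenerate W" and v: "v \<in> W" "v \<noteq> 0" and u: "u \<in> W" "u \<noteq> 0"
  obtains S where "S \<in> similitudes W 1" "S v = u"
proof -
  have sub: "subspace W" using W by (simp add: nondegenerate_def)
  have direct: "\<exists>S\<in>similitudes W 1. S x = y" if xy: "x \<in> W" "y \<in> W" "B x y \<noteq> 0" for x y
  proof -
    \<comment> \<open>The scalar makes the coefficient of \<open>y - x\<close> at the point
      \<open>x\<close> equal to 1, since \<open>B x (y - x) = B x y\<close>.\<close>
    let ?S = "restrict (\<lambda>z. z + (inverse (B x y) * B z (y - x)) \<star> (y - x)) W"
    have "?S \<in> similitudes W 1"
      by (rule transvection_similitude) (use sub xy in \<open>auto simp: subspace_diff\<close>)
    moreover have "?S x = y" using xy by simp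
    ultimately show ?thesis by blast
  qed
  obtain y1 where y1: "y1 \<in> W" "B v y1 = 1" using hyperbolic_partner[OF W v] .
  obtain y2 where y2: "y2 \<in> W" "B u y2 = 1" using hyperbolic_partner[OF W u] .
  \<comment> \<open>A space is not the union of two proper subspaces: one of \<open>y1\<close>,
    \<open>y2\<close> and \<open>y1 + y2\<close> avoids both hyperplanes.\<close>
  have "\<exists>z\<in>W. B v z \<noteq> 0 \<and> B u z \<noteq> 0"
  proof (cases "B u y1 = 0 \<and> B v y2 = 0")
    case True
    thus ?thesis using y1 y2 sub by (intro bexI[of _ "y1 + y2"]) (auto simp: subspace_add)
  next
    case False
    thus ?thesis using y1 y2 by (metis zero_neq_one)
  qed
  then obtain z where z: "z \<in> W" "B v z \<noteq> 0" "B u z \<noteq> 0" by blast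
  have "B z u \<noteq> 0" using z form_swap[of u z] by simp
  then obtain S T where S: "S \<in> similitudes W 1" "S v = z" and T: "T \<in> similitudes W 1" "T z = u"
    using direct[OF v(1) z(1,2)] direct[OF z(1) u(1)] by blast
  have "restrict (\<lambda>x. T (S x)) W \<in> similitudes W 1"
    using compose_similitudes[OF sub T(1) S(1)] by simp
  moreover have "restrict (\<lambda>x. T (S x)) W v = u" using S T v by simp
  ultimately show ?thesis by (rule that)
qed

text \<open>Composition with an isometry taking \<open>a\<close> to \<open>b\<close> injects one
  fibre into the other. Exchanging \<open>a\<close> and \<open>b\<close> then gives
  equality.\<close>

lemma card_similitudes_fibre_le:
  assumes W: "nondegenerate W" and a: "a \<in> W" "a \<noteq> 0" and b: "b \<in> W" "b \<noteq> 0" and v: "v \<in> W"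
  shows "card {M \<in> similitudes W k. M v = a} \<le> card {M \<in> similitudes W k. M v = b}"
proof -
  have sub: "subspace W" and fin: "finite W" using W by (simp_all add: nondegenerate_def)
  obtain S where S: "S \<in> similitudes W 1" "S a = b" using isometries_transitive[OF W a b] .
  have inj: "inj_on S W" by (rule inj_on_similitude[OF W S(1)]) simp
  show ?thesis
  proof (rule card_inj_on_le)
    show "inj_on (\<lambda>M. restrict (\<lambda>x. S (M x)) W) {M \<in> similitudes W k. M v = a}"
    proof (rule inj_onI)
      fix M N assume *: "M \<in> {M \<in> similitudes W k. M v = a}" "N \<in> {M \<in> similitudes W k. M v = a}"
        "restrict (\<lambda>x. S (M x)) W = restrict (\<lambda>x. S (N x)) W"
      show "M = N"
      proof (rule extensionalityI[of _ W])
        fix x assume x: "x \<in> W"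
        have "S (M x) = S (N x)" using fun_cong[OF *(3), of x] x by simp
        thus "M x = N x"
          by (rule inj_onD[OF inj]) (use *(1,2) x in \<open>auto intro: similitudesD(1)\<close>)
      qed (use *(1,2) in \<open>auto dest: similitudesD(6)\<close>)
    qed
    show "(\<lambda>M. restrict (\<lambda>x. S (M x)) W) ` {M \<in> similitudes W k. M v = a} \<subseteq> {M \<in> similitudes W k. M v = b}"
    proof (rule image_subsetI)
      fix M assume M: "M \<in> {M \<in> similitudes W k. M v = a}"
      hence "restrict (\<lambda>x. S (M x)) W \<in> similitudes W (1 * k)"
        by (intro compose_similitudes[OF sub S(1)]) simp
      thus "restrict (\<lambda>x. S (M x)) W \<in> {M \<in> similitudes W k. M v = b}"
        using M S(2) v by simp
    qed
  qed (simp add: finite_similitudes[OF fin])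
qed

text \<open>Orbit counting: \<open>M v\<close> is nonzero by injectivity, and the fibres of the
  evaluation at \<open>v\<close> over nonzero vectors are equally large.\<close>

lemma card_similitudes_stabilizer:
  assumes W: "nondegenerate W" and v: "v \<in> W" "v \<noteq> 0" and k: "k \<noteq> 0"
  shows "card (similitudes W k) = (card W - 1) * card {M \<in> similitudes W k. M v = v}"
proof -
  have sub: "subspace W" and fin: "finite W" using W by (simp_all add: nondegenerate_def)
  have "M v \<in> W - {0}" if M: "M \<in> similitudes W k" for M
  proof -
    have "M 0 = 0" using similitudesD(3)[OF M v(1), of 0] by simp
    hence "M v \<noteq> 0" using inj_onD[OF inj_on_similitude[OF W M k], of v 0] v subspace_0[OF sub] by auto
    thus ?thesis using similitudesD(1)[OF M v(1)] by simp
  qed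
  hence "similitudes W k = (\<Union>u\<in>W - {0}. {M \<in> similitudes W k. M v = u})" by auto
  hence "card (similitudes W k) = card (\<Union>u\<in>W - {0}. {M \<in> similitudes W k. M v = u})"
    by (rule arg_cong)
  also have "\<dots> = (\<Sum>u\<in>W - {0}. card {M \<in> similitudes W k. M v = u})"
    by (rule card_UN_disjoint) (use fin finite_similitudes[OF fin] in auto)
  also have "\<dots> = (\<Sum>u\<in>W - {0}. card {M \<in> similitudes W k. M v = v})"
  proof (rule sum.cong[OF refl])
    fix u assume "u \<in> W - {0}"
    hence u: "u \<in> W" "u \<noteq> 0" by auto
    show "card {M \<in> similitudes W k. M v = u} = card {M \<in> similitudes W k. M v = v}"
      by (rule antisym) (rule card_similitudes_fibre_le[OF W u v v(1)] card_similitudes_fibre_le[OF W v u v(1)])+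
  qed
  also have "\<dots> = (card W - 1) * card {M \<in> similitudes W k. M v = v}"
    using subspace_0[OF sub] fin by simp
  finally show ?thesis .
qed

end

section \<open>The stabilizer of a vector\<close>

locale hyperbolic_pair = alternating_form scale B
  for scale :: "'f::{field,finite} \<Rightarrow> 'v::ab_group_add \<Rightarrow> 'v" (infixr \<open>\<star>\<close> 75)
    and B :: "'v \<Rightarrow> 'v \<Rightarrow> 'f" +
  fixes W :: "'v set" and v w :: 'v
  assumes nondegenerate_W: "nondegenerate W" and v_in: "v \<in> W" and w_in: "w \<in> W"
    and form_vw [simp]: "B v w = 1"
begin

definition perp :: "'v set" where
  "perp = {x \<in> W. B v x = 0 \<and> B w x = 0}"

text \<open>Orthogonal projection along the hyperbolic plane spanned by \<open>v\<close> and
  \<open>w\<close>. The \<open>v\<close>-coordinate of \<open>x\<close> is \<open>B x w\<close>, and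
  its \<open>w\<close>-coordinate is \<open>B v x\<close>.\<close>

definition proj :: "'v \<Rightarrow> 'v" where
  "proj x = x - B x w \<star> v - B v x \<star> w"

section \<open>Coordinates with respect to a hyperbolic pair\<close>

lemma subspace_W: "subspace W" and finite_W: "finite W"
  using nondegenerate_W by (simp_all add: nondegenerate_def)

lemma form_wv [simp]: "B w v = - 1"
  using form_swap[of w v] by simp

lemma in_W [simp, intro]:
  "x \<in> W \<Longrightarrow> y \<in> W \<Longrightarrow> x + y \<in> W" "x \<in> W \<Longrightarrow> a \<star> x \<in> W"
  "x \<in> W \<Longrightarrow> y \<in> W \<Longrightarrow> x - y \<in> W" "v \<in> W" "w \<in> W" "0 \<in> W"
  using subspace_W v_in w_in by (auto simp: subspace_add subspace_scale subspace_diff subspace_0)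

lemma perpD [simp]:
  assumes "y \<in> perp"
  shows "y \<in> W" "B v y = 0" "B w y = 0" "B y v = 0" "B y w = 0"
  using assms form_swap[of v y] form_swap[of w y] by (simp_all add: perp_def)

lemma subspace_perp: "subspace perp" and finite_perp: "finite perp"
  using finite_W by (auto simp: perp_def subspace_def simp del: perpD)

lemma in_perp [simp, intro]:
  "x \<in> perp \<Longrightarrow> y \<in> perp \<Longrightarrow> x + y \<in> perp" "x \<in> perp \<Longrightarrow> a \<star> x \<in> perp"
  "x \<in> perp \<Longrightarrow> y \<in> perp \<Longrightarrow> x - y \<in> perp" "x \<in> perp \<Longrightarrow> - x \<in> perp" "0 \<in> perp"
  using subspace_perp by (auto simp: subspace_add subspace_scale subspace_diff subspace_0 subspace_neg)

lemma proj_in [simp]: "x \<in> W \<Longrightarrow> proj x \<in> perp"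
  using form_swap[of w x] by (simp add: perp_def proj_def del: perpD)

lemma proj_linear [simp]: "proj (x + y) = proj x + proj y" "proj (a \<star> x) = a \<star> proj x"
  by (simp_all add: proj_def algebra_simps)

lemma proj_perp [simp]: "y \<in> perp \<Longrightarrow> proj y = y"
  by (simp add: proj_def)

lemma proj_pair [simp]: "proj v = 0" "proj w = 0"
  by (simp_all add: proj_def)

lemma decompose: "B x w \<star> v + proj x + B v x \<star> w = x"
  by (simp add: proj_def)

lemma coordinates [simp]:
  assumes "y \<in> perp"
  shows "B (a \<star> v + y + c \<star> w) w = a" "B v (a \<star> v + y + c \<star> w) = c" 
    "proj (a \<star> v + y + c \<star> w) = y"
  using assms by simp_all

lemma coordinates_eq_iff:
  assumes "y \<in> perp" "y' \<in> perp"
  shows "a \<star> v + y + c \<star> w = a' \<star> v + y' + c' \<star> w \<longleftrightarrow> a = a' \<and> y = y' \<and> c = c'"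
  using coordinates[OF assms(1), of a c] coordinates[OF assms(2), of a' c'] by metis

lemma form_proj: 
  assumes "x \<in> W" "y \<in> W"
  shows "B x y = B x w * B v y - B v x * B y w + B (proj x) (proj y)"
proof -
  have "B x y = B (B x w \<star> v + proj x + B v x \<star> w) (B y w \<star> v + proj y + B v y \<star> w)"
    by (simp only: decompose)
  also have "\<dots> = B x w * B v y - B v x * B y w + B (proj x) (proj y)"
    using assms by (simp add: algebra_simps)
  finally show ?thesis .
qed

lemma nondegenerate_perp: "nondegenerate perp"
  unfolding nondegenerate_def
proof (intro conjI ballI impI)
  fix x assume x: "x \<in> perp" "x \<noteq> 0"
  then obtain y where y: "y \<in> W" "B x y \<noteq> 0"
    using nondegenerate_W by (metis nondegenerate_def perpD(1))
  have "B x (proj y) \<noteq> 0" using form_proj[of x y] x y by simp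
  thus "\<exists>y\<in>perp. B x y \<noteq> 0" using proj_in[OF y(1)] by blast
qed (rule finite_perp subspace_perp)+

lemma card_perp: "card W = CARD('f) ^ 2 * card perp"
proof -
  have "bij_betw (\<lambda>(a, y, c). a \<star> v + y + c \<star> w) (UNIV \<times> perp \<times> UNIV) W"
    by (rule bij_betw_byWitness[where f' = "\<lambda>x. (B x w, proj x, B v x)"])
      (auto simp: decompose simp del: form_add_left form_add_right)
  from bij_betw_same_card[OF this] show ?thesis
    by (simp add: card_cartesian_product power2_eq_square mult_ac)
qed

text \<open>In the decomposition \<open>W = \<langle>v\<rangle> + perp + \<langle>w\<rangle>\<close>, a similitude with multiplier \<open>k\<close> that fixes \<open>v\<close> induces a
  similitude \<open>N\<close> of \<open>perp\<close> and maps \<open>w\<close> to \<open>c v + b + k w\<close>. The image of \<open>y \<in> perp\<close> must be orthogonal to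
  the image of \<open>w\<close>, which forces its \<open>v\<close>-coordinate.\<close>

definition extension :: "'f \<Rightarrow> ('v \<Rightarrow> 'v) \<Rightarrow> 'v \<Rightarrow> 'f \<Rightarrow> 'v \<Rightarrow> 'v" where
  "extension k N b c = restrict (\<lambda>x. (B x w + inverse k * B b (N (proj x)) + B v x * c) \<star> v
     + (N (proj x) + B v x \<star> b) + (k * B v x) \<star> w) W"

lemma extension_similitude:
  assumes k: "k \<noteq> 0" and N: "N \<in> similitudes perp k" and b: "b \<in> perp"
  shows "extension k N b c \<in> similitudes W k" "extension k N b c v = v"
proof -
  note N' = similitudesD(1-4)[OF N]
  have N0: "N 0 = 0" using N'(3)[of 0 0] by simp
  show "extension k N b c v = v"
    by (simp add: extension_def N0)
  show "extension k N b c \<in> similitudes W k"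
    unfolding extension_def
  proof (rule similitudes_restrictI[OF subspace_W])
    fix x y assume xy: "x \<in> W" "y \<in> W"
    show "(B (x + y) w + inverse k * B b (N (proj (x + y))) + B v (x + y) * c) \<star> v + (N (proj (x + y)) + B v (x + y) \<star> b)
       + (k * B v (x + y)) \<star> w =
       (B x w + inverse k * B b (N (proj x)) + B v x * c) \<star> v + (N (proj x) + B v x \<star> b) + (k * B v x) \<star> w
       + ((B y w + inverse k * B b (N (proj y)) + B v y * c) \<star> v + (N (proj y) + B v y \<star> b) + (k * B v y) \<star> w)"
      using xy by (simp add: N' algebra_simps)
    have "B (N (proj x)) b = - B b (N (proj x))" "B (N (proj y)) b = - B b (N (proj y))"
      by (rule form_swap)+
    moreover have "N (proj x) + B v x \<star> b \<in> perp" "N (proj y) + B v y \<star> b \<in> perp"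
      using xy b N' by auto
    ultimately show "B ((B x w + inverse k * B b (N (proj x)) + B v x * c) \<star> v + (N (proj x) + B v x \<star> b) + (k * B v x) \<star> w)
        ((B y w + inverse k * B b (N (proj y)) + B v y * c) \<star> v + (N (proj y) + B v y \<star> b) + (k * B v y) \<star> w) = k * B x y"
      using xy b k N' by (subst form_proj[of x y]) (simp_all add: field_simps)
  qed (use b N' in \<open>auto simp: algebra_simps\<close>)
qed

text \<open>Every element of the stabilizer is an extension: \<open>N\<close> is its induced map on
  \<open>perp\<close>, while \<open>b\<close> and \<open>c\<close> are coordinates of
  \<open>M w\<close>.\<close>

lemma stabilizer_restriction:
  assumes k: "k \<noteq> 0" and M: "M \<in> similitudes W k" and Mv: "M v = v"
  shows "restrict (\<lambda>y. proj (M y)) perp \<in> similitudes perp k"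
    and "extension k (restrict (\<lambda>y. proj (M y)) perp) (proj (M w)) (B (M w) w) = M"
proof -
  note M' = similitudesD(1-4)[OF M]
  have form_v: "B v (M x) = k * B v x" if "x \<in> W" for x
    using M'(4)[OF v_in that] Mv by simp
  \<comment> \<open>Since \<open>y\<close> and \<open>w\<close> are orthogonal, so are
    \<open>M y\<close> and \<open>M w\<close>; this forces the \<open>v\<close>-coordinate of
    \<open>M y\<close> that \<open>extension\<close> prescribes.\<close>
  have form_w: "inverse k * B (proj (M w)) (proj (M y)) = B (M y) w" if y: "y \<in> perp" for y
  proof -
    have "0 = B (M y) (M w)" using M'(4)[of y w] y by simp
    also have "\<dots> = k * B (M y) w + B (proj (M y)) (proj (M w))"
      using y M' form_v[of y] form_v[of w] by (subst form_proj) auto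
    finally show ?thesis using k form_swap[of "proj (M w)" "proj (M y)"] 
      by (simp add: field_simps add_eq_0_iff)
  qed
  show "restrict (\<lambda>y. proj (M y)) perp \<in> similitudes perp k"
  proof (rule similitudes_restrictI[OF subspace_perp])
    fix x y assume xy: "x \<in> perp" "y \<in> perp"
    have "B (M x) (M y) = B (proj (M x)) (proj (M y))"
      using xy form_v[of x] form_v[of y] by (subst form_proj) (auto simp: M')
    thus "B (proj (M x)) (proj (M y)) = k * B x y" using xy by (simp add: M')
  qed (auto simp: M')
  show "extension k (restrict (\<lambda>y. proj (M y)) perp) (proj (M w)) (B (M w) w) = M"
  proof (rule extensionalityI[of _ W])
    fix x assume x: "x \<in> W"
    define y where "y = proj x"
    have y: "y \<in> perp" using x by (simp add: y_def)
    have My: "B (M y) w \<star> v + proj (M y) = M y" 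
      using decompose[of "M y"] form_v[of y] y by simp
    have Mw: "B (M w) w \<star> v + proj (M w) + k \<star> w = M w"
      using decompose[of "M w"] form_v[of w] by simp
    have "M x = M (B x w \<star> v + y + B v x \<star> w)"
      by (simp only: y_def decompose)
    also have "\<dots> = B x w \<star> v + M y + B v x \<star> M w"
      using y by (simp add: M' Mv)
    also have "\<dots> = B x w \<star> v + (B (M y) w \<star> v + proj (M y)) + B v x \<star> (B (M w) w \<star> v + proj (M w) + k \<star> w)"
      by (simp only: My Mw)
    also have "\<dots> = extension k (restrict (\<lambda>y. proj (M y)) perp) (proj (M w)) (B (M w) w) x"
      using x y by (simp add: extension_def y_def[symmetric] form_w algebra_simps)
    finally show "extension k (restrict (\<lambda>y. proj (M y)) perp) (proj (M w)) (B (M w) w) x = M x" ..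
  qed (use M in \<open>auto simp: extension_def dest: similitudesD(6)\<close>)
qed

text \<open>The triples \<open>(N, b, c)\<close> parametrize the stabilizer bijectively. An
  arbitrary summand \<open>F\<close> serves both the size of the stabilizer and the weighted sum
  over it.\<close>

lemma sum_stabilizer:
  assumes k: "k \<noteq> 0"
  shows "(\<Sum>M | M \<in> similitudes W k \<and> M v = v. F M) =
    (\<Sum>N\<in>similitudes perp k. \<Sum>b\<in>perp. \<Sum>c\<in>UNIV. (F (extension k N b c) :: real))"
proof -
  have "(\<Sum>M | M \<in> similitudes W k \<and> M v = v. F M) =
    (\<Sum>(N, b, c)\<in>similitudes perp k \<times> perp \<times> UNIV. F (extension k N b c))"
  proof (rule sum.reindex_bij_witness[where i = "\<lambda>(N, b, c). extension k N b c"
      and j = "\<lambda>M. (restrict (\<lambda>y. proj (M y)) perp, proj (M w), B (M w) w)"])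
    fix x assume "x \<in> similitudes perp k \<times> perp \<times> (UNIV :: 'f set)"
    then obtain N b c where x: "x = (N, b, c)" and N: "N \<in> similitudes perp k" and b: "b \<in> perp"
      by auto
    note N' = similitudesD(1-4)[OF N]
    have N0: "N 0 = 0" using N'(3)[of 0 0] by simp
    have ew: "extension k N b c w = c \<star> v + b + k \<star> w"
      by (simp add: extension_def N0)
    have "restrict (\<lambda>y. proj (extension k N b c y)) perp = N"
      by (rule extensionalityI[of _ perp])
        (use N similitudesD(6)[OF N] in \<open>auto simp: extension_def N'\<close>)
    thus "(\<lambda>M. (restrict (\<lambda>y. proj (M y)) perp, proj (M w), B (M w) w)) ((\<lambda>(N, b, c). extension k N b c) x) = x"
      using b by (simp add: x ew)
    show "(\<lambda>(N, b, c). extension k N b c) x \<in> {M \<in> similitudes W k. M v = v}"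
      using extension_similitude[OF k N b] by (simp add: x)
  qed (use stabilizer_restriction[OF k] in \<open>auto simp: similitudesD(1)\<close>)
  thus ?thesis by (simp add: sum.cartesian_product)
qed

text \<open>The \<open>v\<close>-coordinate of a fixed vector is free because \<open>v\<close>
  itself is fixed; this is the factor \<open>CARD('f)\<close>. The three equations compare the
  \<open>w\<close>-, \<open>perp\<close>- and \<open>v\<close>-coordinates in this order.\<close>

lemma card_fixed_extension:
  assumes N: "N \<in> similitudes perp k" and b: "b \<in> perp"
  shows "card (fixed W (extension k N b c)) = CARD('f) *
    card {(y, t). y \<in> perp \<and> k * t = t \<and> N y + t \<star> b = y \<and> inverse k * B b (N y) + t * c = 0}"
    (is "_ = _ * card ?K")
proof -
  note N' = similitudesD(1-4)[OF N]
  have iff: "extension k N b c (a \<star> v + y + t \<star> w) = a \<star> v + y + t \<star> w \<longleftrightarrow> (y, t) \<in> ?K" 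
    if y: "y \<in> perp" for a y t
  proof -
    have "extension k N b c (a \<star> v + y + t \<star> w) =
      (a + inverse k * B b (N y) + t * c) \<star> v + (N y + t \<star> b) + (k * t) \<star> w"
      unfolding extension_def by (subst restrict_apply) (simp only: coordinates[OF y], use y in auto)
    thus ?thesis using y b N' by (auto simp: coordinates_eq_iff simp del: scale_left_distrib)
  qed
  have "bij_betw (\<lambda>(a, y, t). a \<star> v + y + t \<star> w) (UNIV \<times> ?K) (fixed W (extension k N b c))"
  proof (rule bij_betw_byWitness[where f' = "\<lambda>x. (B x w, proj x, B v x)"])
    show "\<forall>x\<in>fixed W (extension k N b c). (\<lambda>(a, y, t). a \<star> v + y + t \<star> w) (B x w, proj x, B v x) = x"
      using decompose by simp
    show "(\<lambda>(a, y, t). a \<star> v + y + t \<star> w) ` (UNIV \<times> ?K) \<subseteq> fixed W (extension k N b c)"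
      using iff by (auto simp: fixed_def)
    show "(\<lambda>x. (B x w, proj x, B v x)) ` fixed W (extension k N b c) \<subseteq> UNIV \<times> ?K"
    proof (rule image_subsetI)
      fix x assume x: "x \<in> fixed W (extension k N b c)"
      hence "proj x \<in> perp" "extension k N b c x = x" by (auto simp: fixed_def)
      hence "(proj x, B v x) \<in> ?K" using iff[of "proj x" "B x w" "B v x", unfolded decompose] by blast
      thus "(B x w, proj x, B v x) \<in> UNIV \<times> ?K" by (rule SigmaI[OF UNIV_I])
    qed
  qed auto
  from bij_betw_same_card[OF this] show ?thesis by (simp add: card_cartesian_product)
qed

text \<open>Membership of \<open>b\<close> in this complement governs the number of fixed vectors of
  the extension. For an isometry \<open>N\<close> it is the image of \<open>N - 1\<close>.\<close>

definition fixed_orth :: "('v \<Rightarrow> 'v) \<Rightarrow> 'v set" where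
  "fixed_orth N = {b \<in> perp. \<forall>y\<in>fixed perp N. B b y = 0}"

lemma card_fixed_perp:
  assumes N: "N \<in> similitudes perp k"
  shows "card (fixed perp N) * card (fixed_orth N) = card perp"
    and "\<exists>d. card (fixed perp N) = CARD('f) ^ d"
  using card_subspace_orth[OF nondegenerate_perp subspace_fixed[OF subspace_perp N]]
  by (auto simp: fixed_orth_def fixed_def)

lemma card_fixed_functional:
  assumes N: "N \<in> similitudes perp k" and b: "b \<in> perp - fixed_orth N"
  shows "card (fixed perp N) = card {y \<in> fixed perp N. B b y = 0} * CARD('f)"
proof -
  obtain u where "u \<in> fixed perp N" "B b u \<noteq> 0" using b by (auto simp: fixed_orth_def)
  moreover have "finite (fixed perp N)" using finite_perp by (simp add: fixed_def)
  ultimately show ?thesis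
    by (intro card_subspace_functional subspace_fixed[OF subspace_perp N])
qed

text \<open>For \<open>k \<noteq> 1\<close> the equation \<open>k * t = t\<close> forces
  \<open>t = 0\<close>. What remains is the kernel of the functional \<open>B b\<close> on the fixed
  space of \<open>N\<close>, which is everything or a hyperplane.\<close>

lemma card_fixed_extension_multiplier:
  assumes N: "N \<in> similitudes perp k" and b: "b \<in> perp" and k: "k \<noteq> 0" "k \<noteq> 1"
  shows "card (fixed W (extension k N b c)) =
    (if b \<in> fixed_orth N then CARD('f) * card (fixed perp N) else card (fixed perp N))"
proof -
  have "{(y, t). y \<in> perp \<and> k * t = t \<and> N y + t \<star> b = y \<and> inverse k * B b (N y) + t * c = 0}
    = {y \<in> fixed perp N. B b y = 0} \<times> {0}"
    using k by (auto simp: fixed_def)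
  hence "card (fixed W (extension k N b c)) = CARD('f) * card {y \<in> fixed perp N. B b y = 0}"
    by (simp add: card_fixed_extension[OF N b] card_cartesian_product)
  moreover have "{y \<in> fixed perp N. B b y = 0} = fixed perp N" if "b \<in> fixed_orth N"
    using that by (auto simp: fixed_orth_def)
  moreover have "card (fixed perp N) = CARD('f) * card {y \<in> fixed perp N. B b y = 0}" if "b \<notin> fixed_orth N"
    using card_fixed_functional[OF N, of b] that b by simp
  ultimately show ?thesis by auto
qed

text \<open>For fixed \<open>y\<close>, \<open>B (N x) y = B (N x) (N y) = B x y\<close>, so the
  image lies in the complement of the fixed space. Both sizes, multiplied by that of the fixed
  space, give the size of \<open>perp\<close>.\<close>

lemma image_minus_id:
  assumes N: "N \<in> similitudes perp 1"
  shows "(\<lambda>x. N x - x) ` perp = fixed_orth N"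
proof (rule card_subset_eq)
  note N' = similitudesD(1-4)[OF N]
  show "finite (fixed_orth N)" using finite_perp by (simp add: fixed_orth_def)
  show sub: "(\<lambda>x. N x - x) ` perp \<subseteq> fixed_orth N"
  proof (rule image_subsetI)
    fix x assume x: "x \<in> perp"
    have "B (N x - x) y = 0" if y: "y \<in> fixed perp N" for y
    proof -
      have "y \<in> perp" "N y = y" using y by (simp_all add: fixed_def)
      thus ?thesis using N'(4)[OF x, of y] by simp
    qed
    thus "N x - x \<in> fixed_orth N" using N'(1)[OF x] x by (simp add: fixed_orth_def)
  qed
  have "card perp = card {x \<in> perp. N x - x = 0} * card ((\<lambda>x. N x - x) ` perp)"
    by (rule card_kernel_image[OF finite_perp]) (auto simp: N')
  also have "{x \<in> perp. N x - x = 0} = fixed perp N" by (auto simp: fixed_def)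
  finally have "card (fixed perp N) * card (fixed_orth N) = card (fixed perp N) * card ((\<lambda>x. N x - x) ` perp)"
    using card_fixed_perp(1)[OF N] by simp
  moreover have "card (fixed perp N) \<noteq> 0" using card_fixed_perp(2)[OF N] by auto
  ultimately show "card ((\<lambda>x. N x - x) ` perp) = card (fixed_orth N)" by simp
qed

text \<open>A solution with \<open>t \<noteq> 0\<close> would put \<open>b\<close> into the image of
  \<open>N - 1\<close>, which is \<open>fixed_orth N\<close>. So \<open>t = 0\<close>, and
  \<open>b\<close> cuts a hyperplane out of the fixed space of \<open>N\<close>.\<close>

lemma card_fixed_extension_isometry_generic:
  assumes N: "N \<in> similitudes perp 1" and b: "b \<in> perp - fixed_orth N"
  shows "card (fixed W (extension 1 N b c)) = card (fixed perp N)"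
proof -
  have orth: "fixed_orth N \<subseteq> perp" "\<And>x a. x \<in> fixed_orth N \<Longrightarrow> a \<star> x \<in> fixed_orth N"
    by (auto simp: fixed_orth_def)
  have t0: "t = 0" if y: "y \<in> perp" "N y + t \<star> b = y" for y t
  proof (rule ccontr)
    assume t: "t \<noteq> 0"
    have "N y - y = - (t \<star> b)" using y(2) by (metis add_diff_cancel_left' minus_diff_eq diff_add_cancel add.commute)
    hence "(- inverse t) \<star> (N y - y) = b" using t by simp
    moreover have "N y - y \<in> fixed_orth N" using image_minus_id[OF N] y(1) by blast
    ultimately show False using orth(2)[of "N y - y" "- inverse t"] b by simp
  qed
  have "y \<in> perp \<and> N y + t \<star> b = y \<and> B b (N y) + t * c = 0 \<longleftrightarrow> y \<in> fixed perp N \<and> B b y = 0 \<and> t = 0" for y t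
    using t0[of y t] by (cases "t = 0") (auto simp: fixed_def)
  hence "{(y, t). y \<in> perp \<and> 1 * t = t \<and> N y + t \<star> b = y \<and> inverse 1 * B b (N y) + t * c = 0}
    = {y \<in> fixed perp N. B b y = 0} \<times> {0}"
    by auto
  thus ?thesis using b card_fixed_functional[OF N b]
    by (simp add: card_fixed_extension[OF N] card_cartesian_product)
qed

text \<open>Here \<open>- b = N z - z\<close> for some \<open>z\<close>, and the substitution of
  \<open>y - t \<star> z\<close> for \<open>y\<close> reduces the second equation to being fixed by
  \<open>N\<close>. The last equation becomes \<open>t * (B b z + c) = 0\<close>, so
  \<open>t\<close> is free exactly for \<open>c0 = - B b z\<close>.\<close>

lemma card_fixed_extension_isometry_special:
  assumes N: "N \<in> similitudes perp 1" and b: "b \<in> fixed_orth N"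
  obtains c0 where "\<And>c. card (fixed W (extension 1 N b c)) =
    (if c = c0 then CARD('f) ^ 2 * card (fixed perp N) else CARD('f) * card (fixed perp N))"
proof -
  note N' = similitudesD(1-4)[OF N]
  have b': "b \<in> perp" and by0: "\<And>y. y \<in> fixed perp N \<Longrightarrow> B b y = 0" using b by (auto simp: fixed_orth_def)
  have "- b \<in> fixed_orth N" using b' by0 by (auto simp: fixed_orth_def)
  hence "- b \<in> (\<lambda>x. N x - x) ` perp" using image_minus_id[OF N] by simp
  then obtain z where z: "- b = N z - z" "z \<in> perp" by (rule imageE)
  have Nz: "N z = z - b" using z(1) by (simp add: algebra_simps)
  define K where "K c = {(y, t). y \<in> perp \<and> 1 * t = t \<and> N y + t \<star> b = y \<and> inverse 1 * B b (N y) + t * c = 0}" for c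
  have fixI: "y - t \<star> z \<in> fixed perp N \<longleftrightarrow> N y + t \<star> b = y" if "y \<in> perp" for y t
  proof -
    have "N (y - t \<star> z) = N y + (- t) \<star> N z"
      using N'(2)[of y "(- t) \<star> z"] N'(3)[of z "- t"] that z by simp
    hence "N (y - t \<star> z) = N y + t \<star> b - t \<star> z" by (simp add: Nz algebra_simps)
    thus ?thesis using that z by (auto simp: fixed_def)
  qed
  have K_iff: "(y, t) \<in> K c \<longleftrightarrow> y \<in> perp \<and> y - t \<star> z \<in> fixed perp N \<and> t * (B b z + c) = 0" for y t c
  proof -
    \<comment> \<open>\<open>B b (N y) = B b y\<close> because \<open>B b b = 0\<close>, and
      \<open>b\<close> is orthogonal to the fixed vector \<open>y - t \<star> z\<close>.\<close>
    have eq: "B b (N y) + t * c = t * (B b z + c)" if y: "y \<in> perp" "N y + t \<star> b = y"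
    proof -
      have "B b y = B b (N y + t \<star> b)" using y(2) by (rule arg_cong[OF sym])
      moreover have "B b (y - t \<star> z) = 0" using by0 fixI y by blast
      ultimately show ?thesis by (simp add: algebra_simps)
    qed
    have "(y, t) \<in> K c \<longleftrightarrow> (y \<in> perp \<and> N y + t \<star> b = y) \<and> B b (N y) + t * c = 0"
      by (auto simp: K_def)
    also have "\<dots> \<longleftrightarrow> (y \<in> perp \<and> N y + t \<star> b = y) \<and> t * (B b z + c) = 0"
      by (rule conj_cong[OF refl]) (simp only: eq)
    finally show ?thesis using fixI[of y t] by blast
  qed
  have cardK: "card (K c) = (if c = - B b z then CARD('f) * card (fixed perp N) else card (fixed perp N))" for c
  proof -
    have "bij_betw (\<lambda>(y, t). (y - t \<star> z, t)) (K c) (fixed perp N \<times> {t. t * (B b z + c) = 0})"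
    proof (rule bij_betw_byWitness[where f' = "\<lambda>(y, t). (y + t \<star> z, t)"])
      have "y \<in> perp" if "y \<in> fixed perp N" for y using that by (simp add: fixed_def)
      thus "(\<lambda>(y, t). (y + t \<star> z, t)) ` (fixed perp N \<times> {t. t * (B b z + c) = 0}) \<subseteq> K c"
        using z(2) by (auto simp: K_iff)
    qed (auto simp: K_iff)
    hence "card (K c) = card (fixed perp N \<times> {t. t * (B b z + c) = 0})"
      by (rule bij_betw_same_card)
    hence "card (K c) = card (fixed perp N) * card {t. t * (B b z + c) = 0}"
      by (simp only: card_cartesian_product)
    moreover have "{t. t * (B b z + c) = 0} = (if c = - B b z then UNIV else {0})"
      by (auto simp: add_eq_0_iff)
    ultimately show ?thesis by simp
  qed
  show ?thesis
  proof (rule that[of "- B b z"])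
    fix c
    show "card (fixed W (extension 1 N b c)) =
      (if c = - B b z then CARD('f) ^ 2 * card (fixed perp N) else CARD('f) * card (fixed perp N))"
      unfolding card_fixed_extension[OF N b'] K_def[symmetric] cardK by (simp add: power2_eq_square)
  qed
qed

end

section \<open>A recursion for the mean over the similitudes\<close>

text \<open>For \<open>n = l\<^sup>d\<close>, the size of a fixed space of dimension \<open>d\<close>, the index set is \<open>{..<d}\<close>. At \<open>s = 1\<close> the
  product is the indicator of \<open>d = 0\<close>.\<close>

definition qpoch :: "nat \<Rightarrow> real \<Rightarrow> nat \<Rightarrow> real" where
  "qpoch l s n = (\<Prod>j | l ^ j < n. 1 - s * real l ^ j)"

lemma qpoch_power: "l > 1 \<Longrightarrow> qpoch l s (l ^ d) = (\<Prod>j<d. 1 - s * real l ^ j)"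
  unfolding qpoch_def by (rule prod.cong) auto

lemma qpoch_power_Suc: "l > 1 \<Longrightarrow> qpoch l s (l ^ Suc d) = qpoch l s (l ^ d) * (1 - s * real l ^ d)"
  by (simp only: qpoch_power prod.lessThan_Suc)

lemma qpoch_power_shift: "l > 1 \<Longrightarrow> qpoch l s (l ^ Suc d) = (1 - s) * qpoch l (real l * s) (l ^ d)"
  by (simp only: qpoch_power prod.lessThan_Suc_shift) (simp add: mult_ac)

text \<open>For \<open>d > 0\<close> both products share the factors \<open>1 - s * l ^ j\<close>
  with \<open>0 < j < d\<close>, and the remaining factors \<open>1 - s * l ^ d\<close> and
  \<open>1 - s\<close> differ by \<open>- s * (n - 1)\<close>. For \<open>d = 0\<close> the value
  \<open>n div l = 0\<close> is harmless, since \<open>n - 1 = 0\<close>.\<close>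

lemma qpoch_difference:
  assumes "l > 1" "n = l ^ d"
  shows "qpoch l (real l * s) n - qpoch l s n = - s * (real n - 1) * qpoch l (real l * s) (n div l)"
proof (cases d)
  case 0
  thus ?thesis using assms by (simp add: qpoch_def)
next
  case (Suc e)
  have "qpoch l (real l * s) (l ^ Suc e) - qpoch l s (l ^ Suc e) = - s * (real (l ^ Suc e) - 1) * qpoch l (real l * s) (l ^ e)"
    using assms(1) by (subst (1) qpoch_power_Suc, simp, subst qpoch_power_shift) (simp_all add: algebra_simps)
  thus ?thesis using assms Suc by simp
qed

text \<open>The average over \<open>b\<close> for a multiplier other than 1: one \<open>b\<close> in
  \<open>n\<close> lies in \<open>fixed_orth N\<close> and contributes at \<open>n\<close>, the
  others contribute at \<open>n div l\<close>.\<close>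

lemma qpoch_multiplier_step:
  assumes "l > 1" "n = l ^ d"
  shows "qpoch l (real l * s) n + (real n - 1) * qpoch l (real l * s) (n div l) = real n * qpoch l s n"
proof (cases d)
  case 0
  thus ?thesis using assms by (simp add: qpoch_def)
next
  case (Suc e)
  have "qpoch l (real l * s) (l ^ Suc e) + (real (l ^ Suc e) - 1) * qpoch l (real l * s) (l ^ e)
    = real (l ^ Suc e) * qpoch l s (l ^ Suc e)"
    using assms(1) by (subst (1) qpoch_power_Suc, simp, subst qpoch_power_shift) (simp_all add: algebra_simps)
  thus ?thesis using assms Suc by simp
qed

text \<open>The average over \<open>b\<close> and \<open>c\<close> for isometries: a special
  \<open>b\<close> contributes at \<open>n\<close> for \<open>l - 1\<close> values of
  \<open>c\<close> and at \<open>l * n\<close> for one value, a generic \<open>b\<close> at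
  \<open>n div l\<close> for all \<open>l\<close> values.\<close>

lemma qpoch_isometry_step:
  assumes "l > 1" "n = l ^ d"
  shows "(real l - 1) * qpoch l (real l * s) n + qpoch l (real l * s) (l * n)
      + real l * ((real n - 1) * qpoch l (real l * s) (n div l))
    = real l * real n * (qpoch l s n - s * qpoch l (real l * s) n)"
proof -
  have "qpoch l (real l * s) (l * n) = qpoch l (real l * s) n * (1 - real l * s * real n)"
    using qpoch_power_Suc[OF assms(1), of "real l * s" d] assms by simp
  moreover have "(real n - 1) * qpoch l (real l * s) (n div l) = real n * qpoch l s n - qpoch l (real l * s) n"
    using qpoch_multiplier_step[OF assms, of s] by simp
  ultimately show ?thesis by (simp only:) (simp add: algebra_simps)
qed

text \<open>\<open>K\<close> takes the same value along \<open>s / l ^ n\<close>, which tends to 0.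
  This gives uniqueness of the solution of the recursion for the means.\<close>

lemma scale_invariant_constant:
  fixes K :: "real \<Rightarrow> real"
  assumes cont: "isCont K 0" and l: "l > 1" and inv: "\<And>s. K (l * s) = K s"
  shows "K s = K 0"
proof -
  have "K (s / l ^ n) = K s" for n
  proof (induction n)
    case (Suc n)
    have "l * (s / l ^ Suc n) = s / l ^ n" using l by simp
    thus ?case using inv[of "s / l ^ Suc n"] Suc by simp
  qed simp
  moreover have "(\<lambda>n. s / l ^ n) \<longlonglongrightarrow> 0"
    using LIMSEQ_divide_realpow_zero[OF l] .
  hence "(\<lambda>n. K (s / l ^ n)) \<longlonglongrightarrow> K 0"
    by (rule isCont_tendsto_compose[OF cont])
  ultimately show ?thesis by (simp add: LIMSEQ_const_iff)
qed

lemma (in alternating_form) card_field_gt_1: "CARD('f) > 1"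
  using card_mono[of UNIV "{0::'f, 1}"] by simp

context hyperbolic_pair begin

text \<open>\<open>fixed_orth N\<close> has density one over the size of the fixed space;
  multiplying by that size keeps divisions out of the statement.\<close>

lemma sum_perp_fixed_orth:
  assumes N: "N \<in> similitudes perp k"
    and "\<And>b. b \<in> fixed_orth N \<Longrightarrow> f b = p" "\<And>b. b \<in> perp - fixed_orth N \<Longrightarrow> f b = q"
  shows "real (card (fixed perp N)) * (\<Sum>b\<in>perp. f b) = real (card perp) * (p + (real (card (fixed perp N)) - 1) * q)"
proof -
  have sub: "fixed_orth N \<subseteq> perp" by (auto simp: fixed_orth_def)
  have "(\<Sum>b\<in>perp. f b) = (\<Sum>b\<in>perp - fixed_orth N. f b) + (\<Sum>b\<in>fixed_orth N. f b)"
    by (rule sum.subset_diff[OF sub finite_perp])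
  also have "\<dots> = real (card (perp - fixed_orth N)) * q + real (card (fixed_orth N)) * p"
    using assms by simp
  also have "real (card (perp - fixed_orth N)) = real (card perp) - real (card (fixed_orth N))"
    using sub finite_subset[OF sub finite_perp] card_mono[OF finite_perp sub]
    by (simp add: card_Diff_subset of_nat_diff)
  finally have "(\<Sum>b\<in>perp. f b) = (real (card perp) - real (card (fixed_orth N))) * q + real (card (fixed_orth N)) * p" .
  moreover have "real (card perp) = real (card (fixed perp N)) * real (card (fixed_orth N))"
    using card_fixed_perp(1)[OF N] by (simp flip: of_nat_mult)
  ultimately show ?thesis by (simp only:) (simp add: algebra_simps)
qed

lemma sum_extension_qpoch:
  assumes k: "k \<noteq> 0" and N: "N \<in> similitudes perp k"
  defines "l \<equiv> CARD('f)" and "n \<equiv> card (fixed perp N)"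
  shows "(\<Sum>b\<in>perp. \<Sum>c\<in>UNIV. qpoch l (real l * s) (card (fixed W (extension k N b c)) div l))
    = real l * real (card perp) * (qpoch l s n - (if k = 1 then s * qpoch l (real l * s) n else 0))"
proof -
  have l: "l > 1" unfolding l_def by (rule card_field_gt_1)
  obtain d where d: "n = l ^ d" using card_fixed_perp(2)[OF N] unfolding n_def l_def by blast
  have n: "real n > 0" using d l by simp
  let ?q = "qpoch l (real l * s)"
  let ?f = "\<lambda>b. \<Sum>c\<in>UNIV. ?q (card (fixed W (extension k N b c)) div l)"
  have sub: "b \<in> perp" if "b \<in> fixed_orth N" for b using that by (simp add: fixed_orth_def)
  have "real n * (\<Sum>b\<in>perp. ?f b) = real n * (real l * real (card perp) * (qpoch l s n - (if k = 1 then s * ?q n else 0)))"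
  proof (cases "k = 1")
    case False
    have "?f b = real l * ?q n" if "b \<in> fixed_orth N" for b
      using card_fixed_extension_multiplier[OF N sub[OF that] k False] that l by (simp add: l_def[symmetric] n_def)
    moreover have "?f b = real l * ?q (n div l)" if "b \<in> perp - fixed_orth N" for b
      using card_fixed_extension_multiplier[OF N _ k False, of b] that by (simp add: l_def[symmetric] n_def)
    ultimately have "real n * (\<Sum>b\<in>perp. ?f b) = real (card perp) * (real l * ?q n + (real n - 1) * (real l * ?q (n div l)))"
      unfolding n_def by (rule sum_perp_fixed_orth[OF N])
    also have "\<dots> = real (card perp) * real l * (?q n + (real n - 1) * ?q (n div l))"
      by (simp add: algebra_simps)
    also have "\<dots> = real (card perp) * real l * (real n * qpoch l s n)"
      by (simp only: qpoch_multiplier_step[OF l d])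
    finally show ?thesis using False by (simp add: mult_ac)
  next
    case True
    note N1 = N[unfolded True]
    have "?f b = (real l - 1) * ?q n + ?q (l * n)" if b: "b \<in> fixed_orth N" for b
    proof -
      obtain c0 where c0: "\<And>c. card (fixed W (extension 1 N b c)) = (if c = c0 then l ^ 2 * n else l * n)"
        using card_fixed_extension_isometry_special[OF N1 b] unfolding l_def n_def by blast
      have "?f b = (\<Sum>c\<in>UNIV. ?q ((if c = c0 then l ^ 2 * n else l * n) div l))"
        by (simp only: c0 True)
      \<comment> \<open>Only \<open>c0\<close> deviates, so the sum is a constant part plus one
        correction.\<close>
      also have "\<dots> = (\<Sum>c\<in>UNIV. ?q n + (if c = c0 then ?q (l * n) - ?q n else 0))"
        using l by (intro sum.cong) (auto simp: power2_eq_square)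
      also have "\<dots> = real l * ?q n + (?q (l * n) - ?q n)"
        by (simp add: sum.distrib l_def)
      finally show ?thesis by (simp add: algebra_simps)
    qed
    moreover have "?f b = real l * ?q (n div l)" if "b \<in> perp - fixed_orth N" for b
      using card_fixed_extension_isometry_generic[OF N1 that] True by (simp add: l_def[symmetric] n_def)
    ultimately have "real n * (\<Sum>b\<in>perp. ?f b) = real (card perp) * ((real l - 1) * ?q n + ?q (l * n) + (real n - 1) * (real l * ?q (n div l)))"
      unfolding n_def by (rule sum_perp_fixed_orth[OF N])
    also have "\<dots> = real (card perp) * ((real l - 1) * ?q n + ?q (l * n) + real l * ((real n - 1) * ?q (n div l)))"
      by (simp only: mult.left_commute)
    also have "\<dots> = real (card perp) * (real l * real n * (qpoch l s n - s * ?q n))"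
      by (simp only: qpoch_isometry_step[OF l d])
    finally show ?thesis using True by (simp add: mult_ac)
  qed
  thus ?thesis using n by simp
qed

lemma sum_stabilizer_qpoch:
  assumes k: "k \<noteq> 0"
  defines "l \<equiv> CARD('f)"
  shows "(\<Sum>M | M \<in> similitudes W k \<and> M v = v. qpoch l (real l * s) (card (fixed W M) div l))
    = real l * real (card perp) * (\<Sum>N\<in>similitudes perp k. qpoch l s (card (fixed perp N))
        - (if k = 1 then s * qpoch l (real l * s) (card (fixed perp N)) else 0))"
  unfolding sum_stabilizer[OF k] sum_distrib_left l_def
  by (rule sum.cong[OF refl sum_extension_qpoch[OF k]])

lemma card_stabilizer:
  assumes k: "k \<noteq> 0"
  shows "real (card {M \<in> similitudes W k. M v = v}) = real CARD('f) * real (card perp) * real (card (similitudes perp k))"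
  using sum_stabilizer[OF k, of "\<lambda>_. 1"] by (simp add: mult_ac)

end

section \<open>The mean over all similitudes\<close>

context alternating_form begin

text \<open>The mean without its normalization: the number of similitudes is shown to be positive
  only in the induction that evaluates this sum.\<close>

definition qpoch_sum :: "'v set \<Rightarrow> 'f \<Rightarrow> real \<Rightarrow> real" where
  "qpoch_sum W k s = (\<Sum>M\<in>similitudes W k. qpoch CARD('f) s (card (fixed W M)))"

lemma similitudes_trivial: "similitudes {0} k = {restrict (\<lambda>x. x) {0}}"
proof (intro Set.set_eqI iffI)
  fix M assume M: "M \<in> similitudes {0} k"
  have "M = restrict (\<lambda>x. x) {0}"
    by (rule extensionalityI[of _ "{0}"]) (use similitudesD(1)[OF M] similitudesD(6)[OF M] in auto)
  thus "M \<in> {restrict (\<lambda>x. x) {0}}" by simp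
next
  fix M :: "'v \<Rightarrow> 'v" assume "M \<in> {restrict (\<lambda>x. x) {0}}"
  thus "M \<in> similitudes {0} k"
    using similitudes_restrictI[of "{0}" "\<lambda>x. x" k] by auto
qed

lemma card_fixed_similitude:
  assumes "nondegenerate W" "M \<in> similitudes W k"
  obtains d where "card (fixed W M) = CARD('f) ^ d"
  using card_subspace_orth[OF assms(1) subspace_fixed, of W M k] assms by (auto simp: nondegenerate_def fixed_def)

text \<open>The factor \<open>n - 1\<close> in \<open>qpoch_difference\<close> is the number of nonzero fixed vectors, so the difference is a
  sum over pairs of a similitude and a nonzero vector fixed by it.\<close>

lemma qpoch_sum_difference:
  assumes W: "nondegenerate W" and k: "k \<noteq> 0"
    and stab: "\<And>v. v \<in> W \<Longrightarrow> v \<noteq> 0 \<Longrightarrow>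
      (\<Sum>M | M \<in> similitudes W k \<and> M v = v. qpoch CARD('f) (real CARD('f) * s) (card (fixed W M) div CARD('f)))
       = real (card {M \<in> similitudes W k. M v = v}) * r"
    and ex: "v0 \<in> W" "v0 \<noteq> 0"
  shows "qpoch_sum W k (real CARD('f) * s) - qpoch_sum W k s = - s * real (card (similitudes W k)) * r"
proof -
  define l where "l = CARD('f)"
  have l: "l > 1" unfolding l_def by (rule card_field_gt_1)
  have sub: "subspace W" and fin: "finite W" using W by (simp_all add: nondegenerate_def)
  note finS = finite_similitudes[OF fin, of k]
  let ?F = "\<lambda>M. qpoch l (real l * s) (card (fixed W M) div l)"
  have "(real (card (fixed W M)) - 1) * x = (\<Sum>v\<in>W - {0}. if M v = v then x else 0)" 
    if M: "M \<in> similitudes W k" for M and x :: real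
  proof -
    have M0: "M 0 = 0" using similitudesD(3)[OF M, of 0 0] subspace_0[OF sub] by simp
    have "{v \<in> W - {0}. M v = v} = fixed W M - {0}" by (auto simp: fixed_def)
    moreover have "0 \<in> fixed W M" using M0 subspace_0[OF sub] by (simp add: fixed_def)
    moreover have "finite (fixed W M)" using fin by (simp add: fixed_def)
    moreover have "card (fixed W M) \<ge> 1"
      using calculation(2,3) by (metis One_nat_def Suc_leI card_gt_0_iff empty_iff)
    ultimately have "real (card {v \<in> W - {0}. M v = v}) = real (card (fixed W M)) - 1"
      by (simp add: of_nat_diff)
    thus ?thesis using fin by (simp add: sum.If_cases Int_def conj_ac)
  qed
  note point = this
  have "qpoch_sum W k (real l * s) - qpoch_sum W k s
    = (\<Sum>M\<in>similitudes W k. qpoch l (real l * s) (card (fixed W M)) - qpoch l s (card (fixed W M)))"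
    by (simp add: qpoch_sum_def sum_subtractf l_def)
  also have "\<dots> = (\<Sum>M\<in>similitudes W k. - s * (\<Sum>v\<in>W - {0}. if M v = v then ?F M else 0))"
  proof (rule sum.cong[OF refl])
    fix M assume M: "M \<in> similitudes W k"
    obtain d where d: "card (fixed W M) = l ^ d" using card_fixed_similitude[OF W M] unfolding l_def .
    show "qpoch l (real l * s) (card (fixed W M)) - qpoch l s (card (fixed W M)) =
      - s * (\<Sum>v\<in>W - {0}. if M v = v then ?F M else 0)"
      unfolding point[OF M, symmetric] using qpoch_difference[OF l d, of s] by (simp only: mult.assoc)
  qed
  also have "\<dots> = - s * (\<Sum>v\<in>W - {0}. \<Sum>M\<in>similitudes W k. if M v = v then ?F M else 0)"
    by (subst sum.swap) (simp only: sum_distrib_left)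
  also have "(\<Sum>v\<in>W - {0}. \<Sum>M\<in>similitudes W k. if M v = v then ?F M else 0)
    = (\<Sum>v\<in>W - {0}. real (card {M \<in> similitudes W k. M v = v}) * r)"
  proof (rule sum.cong[OF refl])
    fix v assume v: "v \<in> W - {0}"
    have "(\<Sum>M\<in>similitudes W k. if M v = v then ?F M else 0) = (\<Sum>M | M \<in> similitudes W k \<and> M v = v. ?F M)"
      using sum.inter_filter[OF finS, of ?F "\<lambda>M. M v = v"] by simp
    also have "\<dots> = real (card {M \<in> similitudes W k. M v = v}) * r"
      unfolding l_def using v by (intro stab) auto
    finally show "(\<Sum>M\<in>similitudes W k. if M v = v then ?F M else 0) = real (card {M \<in> similitudes W k. M v = v}) * r" .
  qed
  \<comment> \<open>By transitivity each stabilizer holds the same share of the similitudes, so the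
    sum over the nonzero vectors restores their full number.\<close>
  also have "\<dots> = (\<Sum>v\<in>W - {0}. real (card (similitudes W k)) / real (card W - 1) * r)"
  proof (rule sum.cong[OF refl])
    fix v assume v: "v \<in> W - {0}"
    have "card W - 1 \<noteq> 0"
      using ex fin subspace_0[OF sub] card_mono[of W "{0, v0}"] by auto
    thus "real (card {M \<in> similitudes W k. M v = v}) * r = real (card (similitudes W k)) / real (card W - 1) * r"
      using card_similitudes_stabilizer[OF W _ _ k, of v] v by (simp del: of_nat_diff)
  qed
  also have "\<dots> = real (card (similitudes W k)) * r"
  proof -
    have "card W - 1 \<noteq> 0"
      using ex fin subspace_0[OF sub] card_mono[of W "{0, v0}"] by auto
    thus ?thesis using fin subspace_0[OF sub] by simp
  qed
  finally show ?thesis by (simp add: l_def)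
qed

text \<open>An abstract family \<open>H\<close> allows one induction for isometries and for other
  multipliers. \<open>W\<close> varies because the induction passes to the complement
  \<open>perp\<close> of a hyperbolic plane; positivity is carried along for the divisions.\<close>

lemma qpoch_sum_eq:
  assumes k: "k \<noteq> 0"
    and H_0: "\<And>s. H 0 s = 1" and H_at_0: "\<And>g. H g 0 = 1" and H_cont: "\<And>g. isCont (H g) 0"
    and H_rec: "\<And>g s. H (Suc g) (real CARD('f) * s) - H (Suc g) s
      = - s * (H g s - (if k = 1 then s * H g (real CARD('f) * s) else 0))"
    and W: "nondegenerate W" "card W = CARD('f) ^ (2 * g)"
  shows "card (similitudes W k) > 0 \<and> qpoch_sum W k s = real (card (similitudes W k)) * H g s"
  using W
proof (induction g arbitrary: W s)
  case 0
  have "0 \<in> W" using 0 by (auto simp: nondegenerate_def subspace_0)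
  moreover have "card W = 1" using 0 by simp
  ultimately have "W = {0}" by (metis card_1_singletonE singletonD)
  moreover have "fixed {0} (restrict (\<lambda>x. x) {0}) = {0::'v}" by (auto simp: fixed_def)
  ultimately show ?case using H_0 by (simp add: qpoch_sum_def similitudes_trivial qpoch_def)
next
  case (Suc g)
  define l where "l = CARD('f)"
  have l: "l > 1" unfolding l_def by (rule card_field_gt_1)
  note W = Suc.prems
  have fin: "finite W" using W by (simp add: nondegenerate_def)
  have stab: "card {M \<in> similitudes W k. M v = v} > 0 \<and> (\<Sum>M | M \<in> similitudes W k \<and> M v = v. qpoch l (real l * s) (card (fixed W M) div l))
       = real (card {M \<in> similitudes W k. M v = v}) * (H g s - (if k = 1 then s * H g (real l * s) else 0))"
    if v: "v \<in> W" "v \<noteq> 0" for v s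
  proof -
    obtain w where w: "w \<in> W" "B v w = 1" using hyperbolic_partner[OF W(1) v] .
    interpret hyperbolic_pair scale B W v w
      by unfold_locales (use W v w in auto)
    have "CARD('f) ^ 2 * card perp = CARD('f) ^ 2 * CARD('f) ^ (2 * g)"
      using card_perp W(2) by (simp add: power2_eq_square)
    hence cp: "card perp = CARD('f) ^ (2 * g)" using l l_def by simp
    note IH = Suc.IH[OF nondegenerate_perp cp]
    have pos: "card (similitudes perp k) > 0" using IH by blast
    have "(\<Sum>M | M \<in> similitudes W k \<and> M v = v. qpoch l (real l * s) (card (fixed W M) div l))
      = real l * real (card perp) * (qpoch_sum perp k s - (if k = 1 then s * qpoch_sum perp k (real l * s) else 0))"
      unfolding l_def sum_stabilizer_qpoch[OF k] by (simp add: sum_subtractf qpoch_sum_def sum_distrib_left)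
    also have "\<dots> = real l * real (card perp) * real (card (similitudes perp k)) * (H g s - (if k = 1 then s * H g (real l * s) else 0))"
      by (simp only: IH[THEN conjunct2]) (simp add: algebra_simps)
    finally have "(\<Sum>M | M \<in> similitudes W k \<and> M v = v. qpoch l (real l * s) (card (fixed W M) div l))
      = real (card {M \<in> similitudes W k. M v = v}) * (H g s - (if k = 1 then s * H g (real l * s) else 0))"
      by (simp only: card_stabilizer[OF k] l_def)
    moreover have "real (card {M \<in> similitudes W k. M v = v}) > 0"
      unfolding card_stabilizer[OF k] cp using pos l by (simp add: l_def)
    ultimately show ?thesis by simp
  qed
  have "card W > 1" unfolding W(2) by (rule one_less_power[OF card_field_gt_1]) simp
  hence "\<not> W \<subseteq> {0}" using card_mono[of "{0}" W] by auto
  then obtain v0 where v0: "v0 \<in> W" "v0 \<noteq> 0" by blast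
  have pos: "card (similitudes W k) > 0"
    using stab[OF v0] card_similitudes_stabilizer[OF W(1) v0 k] \<open>card W > 1\<close> by simp
  \<comment> \<open>The normalized sum and \<open>H (Suc g)\<close> satisfy the same difference
    equation, so \<open>K\<close> is invariant under scaling by \<open>l\<close>. Being continuous
    and zero at 0, it vanishes.\<close>
  define K where "K s = qpoch_sum W k s / real (card (similitudes W k)) - H (Suc g) s" for s
  have "K s = K 0"
  proof (rule scale_invariant_constant[of _ "real l"])
    show "isCont K 0"
      unfolding K_def qpoch_sum_def qpoch_def using H_cont pos by (intro continuous_intros) auto
    fix s
    have "qpoch_sum W k (real l * s) - qpoch_sum W k s
      = - s * real (card (similitudes W k)) * (H g s - (if k = 1 then s * H g (real l * s) else 0))"
      unfolding l_def by (rule qpoch_sum_difference[OF W(1) k _ v0]) (use stab l_def in auto)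
    also have "\<dots> = real (card (similitudes W k)) * (H (Suc g) (real l * s) - H (Suc g) s)"
      using H_rec[of g s] by (simp add: l_def)
    finally show "K (real l * s) = K s"
      using pos by (simp add: K_def field_simps)
  qed (use l in simp)
  also have "K 0 = 0"
    using pos H_at_0 by (simp add: K_def qpoch_sum_def qpoch_def)
  finally show ?case using pos by (simp add: K_def field_simps)
qed

text \<open>A fixed space of positive dimension contributes the vanishing factor with
  \<open>j = 0\<close>, a trivial one the empty product.\<close>

lemma qpoch_sum_one:
  assumes W: "nondegenerate W"
  shows "qpoch_sum W k 1 = real (card {M \<in> similitudes W k. fixed W M = {0}})"
proof -
  have fin: "finite W" and z: "0 \<in> W" using W by (simp_all add: nondegenerate_def subspace_0)
  have l: "CARD('f) > 1" by (rule card_field_gt_1)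
  have "qpoch CARD('f) 1 (card (fixed W M)) = (if fixed W M = {0} then 1 else 0)" if M: "M \<in> similitudes W k" for M
  proof -
    obtain d where d: "card (fixed W M) = CARD('f) ^ d" using card_fixed_similitude[OF W M] .
    have z': "0 \<in> fixed W M" using subspace_fixed[OF _ M] W by (simp add: nondegenerate_def subspace_0)
    show ?thesis
    proof (cases d)
      case 0
      hence "fixed W M = {0}" using d z' by (metis card_1_singletonE power_0 singletonD)
      thus ?thesis using d 0 by (simp add: qpoch_def)
    next
      case (Suc e)
      have "card (fixed W M) > 1" unfolding d Suc by (rule one_less_power[OF l]) simp
      hence "card (fixed W M) \<noteq> card {0 :: 'v}" by simp
      hence "fixed W M \<noteq> {0}" by (rule contrapos_nn) (rule arg_cong)
      thus ?thesis using qpoch_power_shift[OF l, of 1 e] d Suc by simp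
    qed
  qed
  hence "qpoch_sum W k 1 = (\<Sum>M\<in>similitudes W k. if fixed W M = {0} then 1 else 0)"
    by (simp add: qpoch_sum_def)
  also have "\<dots> = real (card {M \<in> similitudes W k. fixed W M = {0}})"
    using finite_similitudes[OF fin, of k] by (simp add: sum.If_cases Int_def)
  finally show ?thesis .
qed

end

section \<open>Euler products\<close>

text \<open>The coefficient of \<open>z ^ n\<close> in Euler's expansion of the infinite product of
  the factors \<open>1 - w * v ^ k * z\<close> over \<open>k \<ge> 0\<close>.\<close>

definition euler_coeff :: "real \<Rightarrow> real \<Rightarrow> nat \<Rightarrow> real" where
  "euler_coeff w v n = (\<Prod>j<n. - (w * v ^ j) / (1 - v ^ Suc j))"

lemma euler_coeff_0 [simp]: "euler_coeff w v 0 = 1"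
  by (simp add: euler_coeff_def)

lemma euler_coeff_Suc:
  assumes "0 < v" "v < 1"
  shows "euler_coeff w v (Suc n) * (1 - v ^ Suc n) = - w * v ^ n * euler_coeff w v n"
proof -
  have "v ^ Suc n < 1" using assms by (intro power_Suc_less_one) auto
  thus ?thesis by (simp add: euler_coeff_def)
qed

text \<open>The condition \<open>w + v < 1\<close> bounds the ratios of consecutive absolute
  coefficients by \<open>w / (1 - v) < 1\<close>, which makes them strictly decreasing. The
  instances have \<open>w = u\<close> and base \<open>v = u\<close> or
  \<open>v = u\<^sup>2\<close>.\<close>

locale euler_product =
  fixes w v :: real
  assumes w_pos: "0 < w" and v_pos: "0 < v" and wv: "w + v < 1"
begin

abbreviation "c \<equiv> euler_coeff w v"

definition "abs_coeff n = (\<Prod>j<n. w * v ^ j / (1 - v ^ Suc j))"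

lemma v_less_1: "v < 1" using w_pos wv by simp

lemma coeff_eq: "c n = (- 1) ^ n * abs_coeff n"
  by (induction n) (simp_all add: euler_coeff_def abs_coeff_def)

lemma ratio: "0 < w * v ^ j / (1 - v ^ Suc j)" "w * v ^ j / (1 - v ^ Suc j) \<le> w / (1 - v)"
proof -
  have "v ^ j \<le> 1" "v ^ Suc j \<le> v" "v ^ Suc j < 1"
    using v_pos v_less_1 power_Suc_le_self[of v j] by (auto simp: power_le_one power_Suc_less_one simp del: power_Suc)
  thus "w * v ^ j / (1 - v ^ Suc j) \<le> w / (1 - v)" "0 < w * v ^ j / (1 - v ^ Suc j)"
    using w_pos v_pos v_less_1 by (auto intro!: frac_le mult_left_le simp del: power_Suc)
qed

lemma ratio_less_1: "w / (1 - v) < 1"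
  using wv v_less_1 by simp

lemma abs_coeff_pos: "abs_coeff n > 0"
  unfolding abs_coeff_def using ratio(1) by (intro prod_pos) auto

lemma abs_coeff_decreasing: "abs_coeff (Suc n) < abs_coeff n"
  using mult_strict_left_mono[OF le_less_trans[OF ratio(2) ratio_less_1] abs_coeff_pos, of n n] by (simp add: abs_coeff_def)

lemma abs_coeff_bound: "abs_coeff n \<le> (w / (1 - v)) ^ n"
  unfolding abs_coeff_def using ratio prod_mono[of "{..<n}" "\<lambda>j. w * v ^ j / (1 - v ^ Suc j)" "\<lambda>_. w / (1 - v)"]
  by (simp add: less_imp_le)

lemma summable_abs_coeff: "summable abs_coeff"
proof (rule summable_comparison_test')
  show "summable (\<lambda>n. (w / (1 - v)) ^ n)"
    using w_pos v_less_1 ratio_less_1 by (intro summable_geometric) auto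
  show "norm (abs_coeff n) \<le> (w / (1 - v)) ^ n" for n using abs_coeff_bound[of n] abs_coeff_pos[of n] by simp
qed

lemma summable_c: "summable c"
  by (rule summable_rabs_cancel) (use summable_abs_coeff abs_coeff_pos in \<open>simp add: coeff_eq abs_mult less_imp_le\<close>)

lemma summable_c_power:
  assumes "\<bar>z\<bar> \<le> 1"
  shows "summable (\<lambda>n. c n * z ^ n)"
proof (rule summable_comparison_test'[OF summable_abs_coeff])
  show "norm (c n * z ^ n) \<le> abs_coeff n" for n
    using assms abs_coeff_pos[of n] by (simp add: coeff_eq abs_mult power_abs mult_left_le power_le_one)
qed

definition "F z = (\<Sum>n. c n * z ^ n)"

text \<open>This is \<open>euler_coeff_Suc\<close> read as a functional equation; its iteration
  peels off one factor of the product at a time.\<close>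

lemma F_functional:
  assumes z: "\<bar>z\<bar> \<le> 1"
  shows "F z = (1 - w * z) * F (v * z)"
proof -
  have vz: "\<bar>v * z\<bar> \<le> 1" using z v_pos v_less_1 by (simp add: abs_mult mult_le_one)
  have "F z - F (v * z) = (\<Sum>n. c n * z ^ n - c n * (v * z) ^ n)"
    unfolding F_def by (rule suminf_diff[OF summable_c_power[OF z] summable_c_power[OF vz]])
  also have "\<dots> = (\<Sum>n. c (Suc n) * z ^ Suc n - c (Suc n) * (v * z) ^ Suc n)"
    using suminf_split_head[OF summable_diff[OF summable_c_power[OF z] summable_c_power[OF vz]]] by simp
  also have "\<dots> = (\<Sum>n. - (w * z) * (c n * (v * z) ^ n))"
  proof (rule arg_cong[where f = suminf], rule ext)
    fix n
    have "c (Suc n) * z ^ Suc n - c (Suc n) * (v * z) ^ Suc n = (c (Suc n) * (1 - v ^ Suc n)) * z ^ Suc n"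
      by (simp add: power_mult_distrib algebra_simps)
    also have "\<dots> = (- w * v ^ n * c n) * z ^ Suc n"
      by (simp only: euler_coeff_Suc[OF v_pos v_less_1])
    also have "\<dots> = - (w * z) * (c n * (v * z) ^ n)" by (simp add: power_mult_distrib)
    finally show "c (Suc n) * z ^ Suc n - c (Suc n) * (v * z) ^ Suc n = - (w * z) * (c n * (v * z) ^ n)" .
  qed
  also have "\<dots> = - (w * z) * F (v * z)"
    unfolding F_def by (rule suminf_mult[OF summable_c_power[OF vz]])
  finally show ?thesis by (simp add: algebra_simps)
qed

lemma product_F: "(\<Prod>k<n. 1 - w * v ^ k) * F (v ^ n) = suminf c"
proof (induction n)
  case 0
  thus ?case by (simp add: F_def)
next
  case (Suc n)
  have "F (v ^ n) = (1 - w * v ^ n) * F (v ^ Suc n)"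
    using F_functional[of "v ^ n"] v_pos v_less_1 by (simp add: power_le_one)
  thus ?case using Suc by (simp add: mult_ac)
qed

text \<open>\<open>F (v ^ n)\<close> tends to \<open>F 0 = 1\<close> by continuity of the power
  series, so \<open>product_F\<close> can be divided by it in the limit.\<close>

lemma product_tendsto: "(\<lambda>n. \<Prod>k<n. 1 - w * v ^ k) \<longlonglongrightarrow> suminf c"
proof -
  have "isCont F 0" unfolding F_def
    by (rule isCont_powser[of c 1]) (use summable_c in simp_all)
  moreover have "(\<lambda>n. v ^ n) \<longlonglongrightarrow> 0" using v_pos v_less_1 by (intro LIMSEQ_power_zero) auto
  ultimately have "(\<lambda>n. F (v ^ n)) \<longlonglongrightarrow> F 0" by (rule isCont_tendsto_compose)
  moreover have "F 0 = 1" unfolding F_def by (subst powser_zero) simp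
  ultimately have lim: "(\<lambda>n. F (v ^ n)) \<longlonglongrightarrow> 1" by simp
  hence "(\<lambda>n. suminf c / F (v ^ n)) \<longlonglongrightarrow> suminf c / 1" by (intro tendsto_intros) auto
  moreover have "eventually (\<lambda>n. F (v ^ n) > 0) sequentially"
    by (rule order_tendstoD(1)[OF lim]) simp
  hence "eventually (\<lambda>n. suminf c / F (v ^ n) = (\<Prod>k<n. 1 - w * v ^ k)) sequentially"
    by eventually_elim (use product_F in \<open>simp add: field_simps\<close>)
  ultimately show ?thesis using tendsto_cong by fastforce
qed

lemma partial_sums_tendsto: "(\<lambda>g. \<Sum>n\<le>g. c n) \<longlonglongrightarrow> suminf c"
  using summable_LIMSEQ'[OF summable_c] .

text \<open>The Leibniz bounds are weak inequalities. Strictness comes from applying them two terms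
  further on: the partial sum strictly decreases from \<open>g\<close> to \<open>g + 2\<close> for
  even \<open>g\<close> and strictly increases for odd \<open>g\<close>.\<close>

lemma partial_sums_alternate: "(- 1) ^ g * ((\<Sum>n\<le>g. c n) - suminf c) > 0"
proof -
  note L = summable_Leibniz'[of abs_coeff, OF summable_LIMSEQ_zero[OF summable_abs_coeff] less_imp_le[OF abs_coeff_pos] less_imp_le[OF abs_coeff_decreasing]]
  have c: "c = (\<lambda>i. (- 1) ^ i * abs_coeff i)" by (rule ext) (rule coeff_eq)
  have S: "(\<Sum>n\<le>Suc (Suc g). c n) = (\<Sum>n\<le>g. c n) + (- 1) ^ g * (abs_coeff (Suc (Suc g)) - abs_coeff (Suc g))"
    by (simp add: c algebra_simps)
  show ?thesis
  proof (cases "even g")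
    case True
    then obtain m where m: "g = 2 * m" by (elim evenE)
    have "suminf c \<le> (\<Sum>n\<le>Suc (Suc g). c n)"
      using L(4)[of "Suc m"] by (simp add: c m lessThan_Suc_atMost del: sum.lessThan_Suc sum.atMost_Suc)
    thus ?thesis using S True abs_coeff_decreasing[of "Suc g"] by simp
  next
    case False
    then obtain m where m: "g = 2 * m + 1" by (elim oddE)
    have "(\<Sum>n\<le>Suc (Suc g). c n) \<le> suminf c"
      using L(2)[of "Suc (Suc m)"] by (simp add: c m lessThan_Suc_atMost del: sum.lessThan_Suc sum.atMost_Suc)
    thus ?thesis using S False abs_coeff_decreasing[of "Suc g"] by simp
  qed
qed

end

section \<open>Infinite products as values of Euler's series\<close>

lemma convergent_prod_geometric:
  fixes u :: real
  assumes "0 < u" "u < 1"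
  shows "convergent_prod (\<lambda>j. 1 - u ^ Suc j)" "convergent_prod (\<lambda>j. 1 + u ^ Suc j)"
proof -
  have "summable (\<lambda>j. u ^ Suc j)" using assms by (simp add: summable_mult summable_geometric)
  thus "convergent_prod (\<lambda>j. 1 - u ^ Suc j)" "convergent_prod (\<lambda>j. 1 + u ^ Suc j)"
    using assms by (auto intro!: abs_convergent_prod_imp_convergent_prod summable_imp_abs_convergent_prod simp del: power_Suc)
qed

lemma prodinf_tendsto:
  fixes f :: "nat \<Rightarrow> real"
  assumes "convergent_prod f"
  shows "(\<lambda>n. \<Prod>j<n. f j) \<longlonglongrightarrow> prodinf f"
  using convergent_prod_LIMSEQ[OF assms]
  by (simp add: lessThan_Suc_atMost[symmetric] del: prod.lessThan_Suc flip: filterlim_sequentially_Suc[of "\<lambda>n. \<Prod>j<n. f j"])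

lemma prodinf_one_minus:
  assumes "0 < u" "u < 1 / 2"
  shows "(\<Prod>j. 1 - u ^ Suc j) = suminf (euler_coeff u u)"
proof -
  interpret euler_product u u by unfold_locales (use assms in auto)
  show ?thesis
    by (rule LIMSEQ_unique[OF prodinf_tendsto[OF convergent_prod_geometric(1)]])
      (use assms product_tendsto in auto)
qed

text \<open>With \<open>E n\<close> the product of the first \<open>n\<close> factors \<open>1 - u ^ j\<close>, this rests on
  \<open>E (2 * n) = O n * A n * E n\<close>, where \<open>O n\<close> collects the odd powers and \<open>A n\<close> the factors \<open>1 + u ^ j\<close>.\<close>

lemma prodinf_inverse_one_plus:
  assumes "0 < u" "u \<le> 1 / 2"
  shows "(\<Prod>j. inverse (1 + u ^ Suc j)) = suminf (euler_coeff u (u\<^sup>2))"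
proof -
  have u2: "u\<^sup>2 \<le> 1 / 4" using power_mono[of u "1/2" 2] assms by (simp add: power_divide)
  interpret euler_product u "u\<^sup>2" by unfold_locales (use assms u2 in auto)
  have u: "0 < u" "u < 1" using assms by auto
  define E where "E n = (\<Prod>j<n. 1 - u ^ Suc j)" for n
  define A where "A n = (\<Prod>j<n. 1 + u ^ Suc j)" for n
  define Od where "Od n = (\<Prod>j<n. 1 - u * (u\<^sup>2) ^ j)" for n
  have split: "E (2 * n) = Od n * A n * E n" for n
  proof (induction n)
    case (Suc n)
    have "E (2 * Suc n) = E (2 * n) * (1 - u ^ Suc (2 * n)) * (1 - u ^ Suc (Suc (2 * n)))"
      by (simp add: E_def)
    also have "1 - u ^ Suc (2 * n) = 1 - u * (u\<^sup>2) ^ n" by (simp add: power_mult)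
    also have "1 - u ^ Suc (Suc (2 * n)) = (1 + u ^ Suc n) * (1 - u ^ Suc n)"
    proof -
      have "u ^ Suc (Suc (2 * n)) = u ^ Suc n * u ^ Suc n" by (simp add: mult_2 power_add)
      thus ?thesis by (simp only:) (simp add: algebra_simps)
    qed
    also have "E (2 * n) = Od n * A n * E n" by (rule Suc.IH)
    also have "Od n * A n * E n * (1 - u * (u\<^sup>2) ^ n) * ((1 + u ^ Suc n) * (1 - u ^ Suc n)) = Od (Suc n) * A (Suc n) * E (Suc n)"
      unfolding Od_def A_def E_def prod.lessThan_Suc by (simp only: mult_ac)
    finally show ?case .
  qed (simp add: E_def A_def Od_def)
  have E: "E \<longlonglongrightarrow> (\<Prod>j. 1 - u ^ Suc j)" and A: "A \<longlonglongrightarrow> (\<Prod>j. 1 + u ^ Suc j)"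
    unfolding E_def A_def using convergent_prod_geometric[OF u] by (intro prodinf_tendsto; simp)+
  have "Od \<longlonglongrightarrow> suminf c" unfolding Od_def by (rule product_tendsto)
  hence "(\<lambda>n. E (2 * n)) \<longlonglongrightarrow> suminf c * (\<Prod>j. 1 + u ^ Suc j) * (\<Prod>j. 1 - u ^ Suc j)"
    unfolding split by (intro tendsto_intros A E)
  \<comment> \<open>The same sequence is a subsequence of \<open>E\<close>. The limit of
    \<open>E\<close> is nonzero and cancels, leaving Euler's identity between the product over odd
    powers and the factors \<open>1 + u ^ j\<close>.\<close>
  moreover have "(\<lambda>n. E (2 * n)) \<longlonglongrightarrow> (\<Prod>j. 1 - u ^ Suc j)"
    by (rule filterlim_compose[OF E]) (simp add: filterlim_subseq strict_mono_def)
  ultimately have "suminf c * (\<Prod>j. 1 + u ^ Suc j) * (\<Prod>j. 1 - u ^ Suc j) = (\<Prod>j. 1 - u ^ Suc j)"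
    by (rule LIMSEQ_unique)
  moreover have "u ^ Suc j < 1" for j using u by (intro power_Suc_less_one) auto
  hence "(\<Prod>j. 1 - u ^ Suc j) \<noteq> 0"
    using prodinf_nonzero[OF convergent_prod_geometric(1)[OF u]] by (metis less_irrefl eq_iff_diff_eq_0)
  ultimately have "suminf c * (\<Prod>j. 1 + u ^ Suc j) = 1" by simp
  moreover have "(\<Prod>j. inverse (1 + u ^ Suc j)) = inverse (\<Prod>j. 1 + u ^ Suc j)"
    by (rule prodinf_inverse[OF convergent_prod_geometric(2)[OF u]])
  ultimately show ?thesis by (metis inverse_unique mult.commute)
qed

text \<open>These polynomials in \<open>s\<close> are the means of \<open>qpoch\<close> over the similitudes with multiplier different from \<open>1\<close>
  and over the isometries, with \<open>u = 1 / l\<close>.\<close>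

definition multiplier_poly :: "real \<Rightarrow> nat \<Rightarrow> real \<Rightarrow> real" where
  "multiplier_poly u g s = (\<Sum>m\<le>g. euler_coeff u u m * s ^ m)"

text \<open>The coefficient of \<open>z ^ r\<close> in the infinite product of
  \<open>1 / (1 - u ^ (2 * k) * z)\<close> over \<open>k \<ge> 1\<close>.\<close>

definition alternating_coeff :: "real \<Rightarrow> nat \<Rightarrow> real" where
  "alternating_coeff u r = (\<Prod>j<r. u\<^sup>2 / (1 - (u\<^sup>2) ^ Suc j))"

text \<open>The coefficient of \<open>z ^ n\<close> in \<open>C (s\<^sup>2 * z) * G (s * z)\<close>,
  where \<open>C\<close> and \<open>G\<close> are the generating functions of
  \<open>alternating_coeff u\<close> and \<open>euler_coeff u u\<close>.\<close>

definition isometry_term :: "real \<Rightarrow> nat \<Rightarrow> real \<Rightarrow> real" where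
  "isometry_term u n s = (\<Sum>r\<le>n. alternating_coeff u r * euler_coeff u u (n - r) * s ^ (n + r))"

definition isometry_poly :: "real \<Rightarrow> nat \<Rightarrow> real \<Rightarrow> real" where
  "isometry_poly u g s = (\<Sum>n\<le>g. isometry_term u n s)"

section \<open>Closed solutions of the recursions\<close>

lemma multiplier_poly_at_0: "multiplier_poly u g 0 = 1"
  by (induction g) (simp_all add: multiplier_poly_def)

lemma isometry_poly_at_0: "isometry_poly u g 0 = 1"
proof -
  have "isometry_term u n 0 = (if n = 0 then 1 else 0)" for n
    by (cases n) (simp_all add: isometry_term_def alternating_coeff_def)
  thus ?thesis by (simp add: isometry_poly_def)
qed

lemma alternating_coeff_0 [simp]: "alternating_coeff u 0 = 1"
  by (simp add: alternating_coeff_def)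

lemma alternating_coeff_Suc:
  assumes "0 < u" "u < 1"
  shows "alternating_coeff u (Suc r) * (1 - (u\<^sup>2) ^ Suc r) = u\<^sup>2 * alternating_coeff u r"
proof -
  have "u\<^sup>2 < 1" using assms by (simp add: power_less_one_iff)
  hence "(u\<^sup>2) ^ Suc r < 1" using assms by (intro power_Suc_less_one) auto
  thus ?thesis by (simp add: alternating_coeff_def)
qed

lemma euler_coeff_base:
  assumes l: "l > 1"
  shows "euler_coeff (1 / l) (1 / l) (Suc m) * (l ^ Suc m - 1) = - euler_coeff (1 / l) (1 / l) m"
proof -
  let ?c = "euler_coeff (1 / l) (1 / l)"
  have "?c (Suc m) * (l ^ Suc m - 1) = l ^ Suc m * (?c (Suc m) * (1 - (1 / l) ^ Suc m))"
    using l by (simp add: field_simps power_divide)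
  also have "?c (Suc m) * (1 - (1 / l) ^ Suc m) = - (1 / l) * (1 / l) ^ m * ?c m"
    by (rule euler_coeff_Suc) (use l in auto)
  also have "l ^ Suc m * (- (1 / l) * (1 / l) ^ m * ?c m) = - ?c m"
    using l by (simp add: field_simps power_divide)
  finally show ?thesis .
qed

lemma alternating_coeff_base:
  assumes l: "l > 1"
  shows "alternating_coeff (1 / l) (Suc r) * (l ^ (2 * Suc r) - 1) = l ^ (2 * r) * alternating_coeff (1 / l) r"
proof -
  let ?c = "alternating_coeff (1 / l)"
  have "((1 / l)\<^sup>2) ^ Suc r = 1 / l ^ (2 * Suc r)"
    by (simp only: power_mult[symmetric] power_divide power_one)
  hence "?c (Suc r) * (l ^ (2 * Suc r) - 1) = l ^ (2 * Suc r) * (?c (Suc r) * (1 - ((1 / l)\<^sup>2) ^ Suc r))"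
    using l by (simp add: right_diff_distrib del: power_Suc mult_Suc_right)
  also have "?c (Suc r) * (1 - ((1 / l)\<^sup>2) ^ Suc r) = (1 / l)\<^sup>2 * ?c r"
    by (rule alternating_coeff_Suc) (use l in auto)
  also have "l ^ (2 * Suc r) * ((1 / l)\<^sup>2 * ?c r) = l ^ (2 * r) * ?c r"
    using l by (simp add: field_simps power2_eq_square)
  finally show ?thesis .
qed

text \<open>The factor \<open>l ^ m - 1\<close> at \<open>s ^ m\<close> kills the constant term and
  absorbs the last denominator of the coefficient, which lowers its index by one.\<close>

lemma multiplier_poly_rec:
  assumes l: "l > 1"
  shows "multiplier_poly (1 / l) (Suc g) (l * s) - multiplier_poly (1 / l) (Suc g) s = - s * multiplier_poly (1 / l) g s"
proof -
  let ?c = "euler_coeff (1 / l) (1 / l)"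
  have "multiplier_poly (1 / l) (Suc g) (l * s) - multiplier_poly (1 / l) (Suc g) s
    = (\<Sum>m\<le>Suc g. ?c m * (l ^ m - 1) * s ^ m)"
    unfolding multiplier_poly_def sum_subtractf[symmetric] by (rule sum.cong) (simp_all add: power_mult_distrib algebra_simps)
  also have "\<dots> = (\<Sum>m\<le>g. ?c (Suc m) * (l ^ Suc m - 1) * s ^ Suc m)"
    by (subst sum.atMost_Suc_shift) simp
  also have "\<dots> = - s * multiplier_poly (1 / l) g s"
    unfolding euler_coeff_base[OF l] multiplier_poly_def sum_distrib_left by (simp add: mult_ac)
  finally show ?thesis .
qed

text \<open>\<open>l ^ (Suc n + r) - 1\<close> is split into
  \<open>l ^ (Suc n - r) * (l ^ (2 * r) - 1)\<close> and \<open>l ^ (Suc n - r) - 1\<close>. The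
  first part lowers the index of \<open>alternating_coeff\<close>, the second that of
  \<open>euler_coeff\<close>.\<close>

lemma isometry_term_rec:
  assumes l: "l > 1"
  shows "isometry_term (1 / l) (Suc n) (l * s) - isometry_term (1 / l) (Suc n) s
    = s\<^sup>2 * isometry_term (1 / l) n (l * s) - s * isometry_term (1 / l) n s"
proof -
  let ?c = "euler_coeff (1 / l) (1 / l)" and ?d = "alternating_coeff (1 / l)"
  let ?P = "\<lambda>r. l ^ (Suc n - r) * (?d r * (l ^ (2 * r) - 1)) * ?c (Suc n - r) * s ^ (Suc n + r)"
  let ?Q = "\<lambda>r. ?d r * (?c (Suc n - r) * (l ^ (Suc n - r) - 1)) * s ^ (Suc n + r)"
  have "isometry_term (1 / l) (Suc n) (l * s) - isometry_term (1 / l) (Suc n) s = (\<Sum>r\<le>Suc n. ?P r + ?Q r)"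
    unfolding isometry_term_def sum_subtractf[symmetric]
  proof (rule sum.cong[OF refl])
    fix r assume "r \<in> {..Suc n}"
    hence "Suc n - r + 2 * r = Suc n + r" by simp
    hence "l ^ (Suc n + r) = l ^ (Suc n - r) * l ^ (2 * r)" unfolding power_add[symmetric] by (simp only:)
    thus "?d r * ?c (Suc n - r) * (l * s) ^ (Suc n + r) - ?d r * ?c (Suc n - r) * s ^ (Suc n + r) = ?P r + ?Q r"
      by (simp only: power_mult_distrib) (simp only: algebra_simps)
  qed
  also have "\<dots> = (\<Sum>r\<le>Suc n. ?P r) + (\<Sum>r\<le>Suc n. ?Q r)" by (rule sum.distrib)
  also have "(\<Sum>r\<le>Suc n. ?P r) = (\<Sum>r\<le>n. ?P (Suc r))" by (subst sum.atMost_Suc_shift) simp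
  also have "\<dots> = s\<^sup>2 * isometry_term (1 / l) n (l * s)"
    unfolding isometry_term_def sum_distrib_left
  proof (rule sum.cong[OF refl])
    fix r assume r: "r \<in> {..n}"
    hence "n - r + 2 * r = n + r" by simp
    hence "l ^ (n - r) * l ^ (2 * r) = l ^ (n + r)" unfolding power_add[symmetric] by (simp only:)
    thus "?P (Suc r) = s\<^sup>2 * (?d r * ?c (n - r) * (l * s) ^ (n + r))"
      unfolding alternating_coeff_base[OF l] by (simp add: power_mult_distrib power2_eq_square mult_ac)
  qed
  also have "(\<Sum>r\<le>Suc n. ?Q r) = (\<Sum>r\<le>n. ?Q r)" by simp
  also have "\<dots> = - s * isometry_term (1 / l) n s"
    unfolding isometry_term_def sum_distrib_left
  proof (rule sum.cong[OF refl])
    fix r assume r: "r \<in> {..n}"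
    hence "Suc n - r = Suc (n - r)" by auto
    thus "?Q r = - s * (?d r * ?c (n - r) * s ^ (n + r))"
      using euler_coeff_base[OF l, of "n - r"] by simp
  qed
  finally show ?thesis by simp
qed

lemma isometry_poly_rec:
  assumes l: "l > 1"
  shows "isometry_poly (1 / l) (Suc g) (l * s) - isometry_poly (1 / l) (Suc g) s
    = - s * (isometry_poly (1 / l) g s - s * isometry_poly (1 / l) g (l * s))"
proof -
  have "isometry_poly (1 / l) (Suc g) (l * s) - isometry_poly (1 / l) (Suc g) s
    = (\<Sum>n\<le>Suc g. isometry_term (1 / l) n (l * s) - isometry_term (1 / l) n s)"
    by (simp only: isometry_poly_def sum_subtractf)
  also have "\<dots> = (\<Sum>n\<le>g. isometry_term (1 / l) (Suc n) (l * s) - isometry_term (1 / l) (Suc n) s)"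
    by (subst sum.atMost_Suc_shift) (simp add: isometry_term_def)
  also have "\<dots> = - s * (isometry_poly (1 / l) g s - s * isometry_poly (1 / l) g (l * s))"
    unfolding isometry_term_rec[OF l] isometry_poly_def
    unfolding sum_subtractf sum_distrib_left[symmetric] by (simp add: algebra_simps power2_eq_square)
  finally show ?thesis .
qed

section \<open>Formal power series under the substitution of \<open>c * z\<close> for
  \<open>z\<close>\<close>

definition fps_dilate :: "real \<Rightarrow> real fps \<Rightarrow> real fps" where
  "fps_dilate c f = Abs_fps (\<lambda>n. c ^ n * fps_nth f n)"

lemma fps_dilate_nth [simp]: "fps_nth (fps_dilate c f) n = c ^ n * fps_nth f n"
  by (simp add: fps_dilate_def)

lemma fps_dilate_mult: "fps_dilate c (f * g) = fps_dilate c f * fps_dilate c g"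
proof (rule fps_ext)
  fix n
  show "fps_nth (fps_dilate c (f * g)) n = fps_nth (fps_dilate c f * fps_dilate c g) n"
    unfolding fps_dilate_nth fps_mult_nth sum_distrib_left
  proof (rule sum.cong[OF refl])
    fix i assume "i \<in> {0..n}"
    hence "c ^ n = c ^ i * c ^ (n - i)" by (simp flip: power_add)
    thus "c ^ n * (fps_nth f i * fps_nth g (n - i)) = c ^ i * fps_nth f i * (c ^ (n - i) * fps_nth g (n - i))"
      by (simp only: mult_ac)
  qed
qed

text \<open>The generating function \<open>A\<close> of the left-hand sides satisfies \<open>A(z) = (1 - u z) A(u\<^sup>2 z)\<close>.\<close>

lemma isometry_term_one:
  assumes u: "0 < u" "u < 1"
  shows "isometry_term u n 1 = euler_coeff u (u\<^sup>2) n"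
proof -
  define L where "L x = 1 - fps_const x * (fps_X :: real fps)" for x
  define G where "G = Abs_fps (euler_coeff u u)"
  define C where "C = Abs_fps (alternating_coeff u)"
  have u2: "0 < u\<^sup>2" "u\<^sup>2 < 1" using u by (auto simp: power_less_one_iff)
  have nth: "fps_nth (L x * f) n = fps_nth f n - (if n = 0 then 0 else x * fps_nth f (n - 1))" for x f n
    by (simp add: L_def algebra_simps mult.assoc fps_X_mult_nth)
  have [simp]: "fps_nth (L x) 0 = 1" for x by (simp add: L_def)
  have dil: "fps_dilate c (L x) = L (c * x)" for c x
  proof (rule fps_ext)
    fix n show "fps_nth (fps_dilate c (L x)) n = fps_nth (L (c * x)) n"
      by (cases n) (auto simp: L_def fps_X_nth)
  qed
  \<comment> \<open>With \<open>L x\<close> standing for \<open>1 - x * z\<close>, this is Euler's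
    functional equation for \<open>G\<close>. Used twice, it relates \<open>G\<close> to its
    dilation by \<open>u\<^sup>2\<close>.\<close>
  have G1: "G = L u * fps_dilate u G"
  proof (rule fps_ext)
    fix n show "fps_nth G n = fps_nth (L u * fps_dilate u G) n"
      unfolding nth using euler_coeff_Suc[OF u, of u "n - 1"] by (cases n) (simp_all add: G_def algebra_simps)
  qed
  hence "fps_dilate u G = L (u * u) * fps_dilate u (fps_dilate u G)"
    using fps_dilate_mult[of u "L u"] dil by metis
  moreover have "fps_dilate u (fps_dilate u G) = fps_dilate (u\<^sup>2) G"
    by (rule fps_ext) (simp add: power2_eq_square power_mult_distrib)
  ultimately have G2: "G = L u * (L (u\<^sup>2) * fps_dilate (u\<^sup>2) G)"
    using G1 by (simp add: power2_eq_square)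
  have C: "L (u\<^sup>2) * C = fps_dilate (u\<^sup>2) C"
  proof (rule fps_ext)
    fix n show "fps_nth (L (u\<^sup>2) * C) n = fps_nth (fps_dilate (u\<^sup>2) C) n"
      unfolding nth using alternating_coeff_Suc[OF u, of "n - 1"] by (cases n) (simp_all add: C_def algebra_simps)
  qed
  \<comment> \<open>The factor \<open>L (u\<^sup>2)\<close> that \<open>G2\<close> produces turns
    \<open>C\<close> into its dilation, so only \<open>L u\<close> survives.\<close>
  have "C * G = L u * fps_dilate (u\<^sup>2) (C * G)"
    unfolding fps_dilate_mult C[symmetric] by (subst G2) (simp only: mult_ac)
  hence rec: "fps_nth (C * G) (Suc n) * (1 - (u\<^sup>2) ^ Suc n) = - u * (u\<^sup>2) ^ n * fps_nth (C * G) n" for n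
    using arg_cong[where f = "\<lambda>f. fps_nth f (Suc n)", of "C * G" "L u * fps_dilate (u\<^sup>2) (C * G)"]
    unfolding nth by (simp add: algebra_simps)
  have "fps_nth (C * G) n = euler_coeff u (u\<^sup>2) n"
  proof (induction n)
    case 0
    show ?case by (simp add: C_def G_def)
  next
    case (Suc n)
    have "(u\<^sup>2) ^ Suc n < 1" using u2 by (intro power_Suc_less_one) auto
    moreover have "fps_nth (C * G) (Suc n) * (1 - (u\<^sup>2) ^ Suc n) = euler_coeff u (u\<^sup>2) (Suc n) * (1 - (u\<^sup>2) ^ Suc n)"
      unfolding rec euler_coeff_Suc[OF u2] Suc ..
    ultimately show ?case by simp
  qed
  thus ?thesis by (simp add: isometry_term_def C_def G_def fps_mult_nth atLeast0AtMost)
qed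

section \<open>Symplectic matrices\<close>

text \<open>Vectors are functions on the naturals with bounded support, so that all dimensions live
  in one type with pointwise addition.\<close>

definition fun_scale :: "'f::field \<Rightarrow> (nat \<Rightarrow> 'f) \<Rightarrow> nat \<Rightarrow> 'f" where
  "fun_scale a x = (\<lambda>i. a * x i)"

definition supported :: "nat \<Rightarrow> (nat \<Rightarrow> 'f::field) set" where
  "supported n = {x. \<forall>i\<ge>n. x i = 0}"

definition symplectic :: "nat \<Rightarrow> (nat \<Rightarrow> 'f::field) \<Rightarrow> (nat \<Rightarrow> 'f) \<Rightarrow> 'f" where
  "symplectic g x y = (\<Sum>i<g. x i * y (g + i) - x (g + i) * y i)"

definition basis_fun :: "nat \<Rightarrow> nat \<Rightarrow> 'f::field" where
  "basis_fun j = (\<lambda>i. if i = j then 1 else 0)"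

definition mat_act :: "nat \<Rightarrow> 'f::field mat \<Rightarrow> (nat \<Rightarrow> 'f) \<Rightarrow> nat \<Rightarrow> 'f" where
  "mat_act n M x = (\<lambda>i. if i < n then (M *\<^sub>v vec n x) $ i else 0)"

lemma sum_fun_apply: "(\<Sum>j\<in>A. F j) i = (\<Sum>j\<in>A. F j (i :: nat) :: 'f::field)"
  by (induction A rule: infinite_finite_induct) auto

lemma alternating_form_symplectic:
  "alternating_form (fun_scale :: 'f::{field,finite} \<Rightarrow> _) (symplectic g)"
proof unfold_locales
  fix x :: "nat \<Rightarrow> 'f"
  show "symplectic g x x = 0" unfolding symplectic_def by (rule sum.neutral) simp
qed (auto simp: fun_scale_def symplectic_def fun_eq_iff algebra_simps sum.distrib sum_subtractf sum_distrib_left)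

lemma basis_fun_supported: "j < n \<Longrightarrow> basis_fun j \<in> supported n"
  by (auto simp: basis_fun_def supported_def)

lemma supported_expand:
  assumes "x \<in> supported n"
  shows "x = (\<Sum>j<n. fun_scale (x j) (basis_fun j))"
proof (rule ext)
  fix i
  have "(\<Sum>j<n. fun_scale (x j) (basis_fun j)) i = (\<Sum>j<n. if i = j then x j else 0)"
    unfolding sum_fun_apply by (rule sum.cong) (auto simp: fun_scale_def basis_fun_def)
  also have "\<dots> = x i" using assms by (auto simp: supported_def)
  finally show "x i = (\<Sum>j<n. fun_scale (x j) (basis_fun j)) i" ..
qed

lemma card_supported:
  "finite (supported n :: (nat \<Rightarrow> 'f::{field,finite}) set)"
  "card (supported n :: (nat \<Rightarrow> 'f::{field,finite}) set) = CARD('f) ^ n"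
proof -
  have bij: "bij_betw (\<lambda>x. restrict x {..<n}) (supported n :: (nat \<Rightarrow> 'f) set) ({..<n} \<rightarrow>\<^sub>E UNIV)"
    by (rule bij_betw_byWitness[where f' = "\<lambda>f i. if i < n then f i else 0"])
      (auto simp: supported_def fun_eq_iff PiE_def extensional_def)
  thus "finite (supported n :: (nat \<Rightarrow> 'f) set)"
    using bij_betw_finite[OF bij] by (simp add: finite_PiE)
  show "card (supported n :: (nat \<Rightarrow> 'f) set) = CARD('f) ^ n"
    using bij_betw_same_card[OF bij] by (simp add: card_PiE)
qed

lemma subspace_supported: "module.subspace fun_scale (supported n :: (nat \<Rightarrow> 'f::{field,finite}) set)"
proof -
  interpret alternating_form "fun_scale :: 'f \<Rightarrow> _" "symplectic 0" by (rule alternating_form_symplectic)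
  show ?thesis by (auto simp: subspace_def supported_def fun_scale_def)
qed

lemma symplectic_basis:
  assumes "i < g"
  shows "symplectic g x (basis_fun (g + i)) = x i" "symplectic g x (basis_fun i) = - x (g + i)"
proof -
  have "symplectic g x (basis_fun (g + i)) = (\<Sum>j<g. if j = i then x j else 0)"
    unfolding symplectic_def basis_fun_def using assms by (intro sum.cong) auto
  thus "symplectic g x (basis_fun (g + i)) = x i" using assms by simp
  have "symplectic g x (basis_fun i) = (\<Sum>j<g. if j = i then - x (g + j) else 0)"
    unfolding symplectic_def basis_fun_def using assms by (intro sum.cong) auto
  thus "symplectic g x (basis_fun i) = - x (g + i)" using assms by simp
qed

lemma nondegenerate_supported:
  "alternating_form.nondegenerate fun_scale (symplectic g) (supported (2 * g) :: (nat \<Rightarrow> 'f::{field,finite}) set)"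
proof -
  interpret alternating_form "fun_scale :: 'f \<Rightarrow> _" "symplectic g" by (rule alternating_form_symplectic)
  show ?thesis unfolding nondegenerate_def
  proof (intro conjI ballI impI)
    fix x :: "nat \<Rightarrow> 'f" assume x: "x \<in> supported (2 * g)" "x \<noteq> 0"
    then obtain i where i: "x i \<noteq> 0" by (auto simp: fun_eq_iff)
    hence i2: "i < 2 * g" using x by (auto simp: supported_def not_le[symmetric])
    show "\<exists>y\<in>supported (2 * g). symplectic g x y \<noteq> 0"
    proof (cases "i < g")
      case True
      thus ?thesis using i symplectic_basis(1)[OF True, of x]
        by (intro bexI[of _ "basis_fun (g + i)"] basis_fun_supported) auto
    next
      case False
      then obtain j where j: "i = g + j" using le_Suc_ex not_less by blast
      thus ?thesis using i i2 symplectic_basis(2)[of j g x]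
        by (intro bexI[of _ "basis_fun j"] basis_fun_supported) auto
    qed
  qed (rule card_supported subspace_supported)+
qed

lemma Omega_carrier [simp]: "Omega_mat g \<in> carrier_mat (2 * g) (2 * g)"
  unfolding Omega_mat_def mult_2 by (rule four_block_carrier_mat) auto

lemma symplectic_eq_Omega: "symplectic g x y = vec (2 * g) x \<bullet> (Omega_mat g *\<^sub>v vec (2 * g) y)"
proof -
  have split: "vec (2 * g) z = vec g z @\<^sub>v vec g (\<lambda>i. z (g + i))" for z :: "nat \<Rightarrow> 'a"
    by (rule eq_vecI) (auto simp: index_append_vec)
  have minus: "- 1\<^sub>m g *\<^sub>v v = - v" if "v \<in> carrier_vec g" for v :: "'a vec"
    using uminus_mult_mat_vec[of v "1\<^sub>m g"] that by simp
  have "Omega_mat g *\<^sub>v vec (2 * g) y = vec g (\<lambda>i. y (g + i)) @\<^sub>v - vec g y"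
    unfolding Omega_mat_def split
    by (subst four_block_mat_mult_vec[where ?nr1.0 = g and ?nr2.0 = g and ?nc1.0 = g and ?nc2.0 = g]) (auto simp: minus)
  moreover have "(vec g x @\<^sub>v vec g (\<lambda>i. x (g + i))) \<bullet> (vec g (\<lambda>i. y (g + i)) @\<^sub>v - vec g y)
    = vec g x \<bullet> vec g (\<lambda>i. y (g + i)) + vec g (\<lambda>i. x (g + i)) \<bullet> (- vec g y)"
    by (rule scalar_prod_append[of _ g _ g]) auto
  ultimately show ?thesis
    unfolding split[of x] 
    by (simp add: symplectic_def scalar_prod_def sum_subtractf atLeast0LessThan sum_negf)
qed

lemma vec_mat_act [simp]:
  "M \<in> carrier_mat n n \<Longrightarrow> vec n (mat_act n M x) = M *\<^sub>v vec n x"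
  by (rule eq_vecI) (auto simp: mat_act_def)

lemma vec_basis_fun: "vec n (basis_fun j) = unit_vec n j"
  by (rule eq_vecI) (auto simp: basis_fun_def unit_vec_def)

lemma symplectic_mat_act:
  assumes M: "M \<in> carrier_mat (2 * g) (2 * g)"
  shows "symplectic g (mat_act (2 * g) M x) (mat_act (2 * g) M y)
    = vec (2 * g) x \<bullet> ((transpose_mat M * Omega_mat g * M) *\<^sub>v vec (2 * g) y)"
proof -
  let ?n = "2 * g"
  have c: "Omega_mat g *\<^sub>v (M *\<^sub>v vec ?n y) \<in> carrier_vec ?n"
    by (intro mult_mat_vec_carrier[of _ _ ?n] Omega_carrier M vec_carrier)
  have "symplectic g (mat_act ?n M x) (mat_act ?n M y) = (M *\<^sub>v vec ?n x) \<bullet> (Omega_mat g *\<^sub>v (M *\<^sub>v vec ?n y))"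
    using M by (simp add: symplectic_eq_Omega)
  also have "\<dots> = (Omega_mat g *\<^sub>v (M *\<^sub>v vec ?n y)) \<bullet> (M *\<^sub>v vec ?n x)"
    by (rule comm_scalar_prod[of _ ?n]) (use M c in auto)
  also have "\<dots> = (transpose_mat M *\<^sub>v (Omega_mat g *\<^sub>v (M *\<^sub>v vec ?n y))) \<bullet> vec ?n x"
    by (rule transpose_vec_mult_scalar[symmetric, OF M _ c]) simp
  also have "\<dots> = vec ?n x \<bullet> (transpose_mat M *\<^sub>v (Omega_mat g *\<^sub>v (M *\<^sub>v vec ?n y)))"
    by (rule comm_scalar_prod[of _ ?n]) (use M c in auto)
  also have "transpose_mat M *\<^sub>v (Omega_mat g *\<^sub>v (M *\<^sub>v vec ?n y)) = (transpose_mat M * Omega_mat g * M) *\<^sub>v vec ?n y"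
  proof -
    have "(transpose_mat M * Omega_mat g * M) *\<^sub>v vec ?n y = (transpose_mat M * Omega_mat g) *\<^sub>v (M *\<^sub>v vec ?n y)"
      by (rule assoc_mult_mat_vec[of _ ?n ?n _ ?n]) (use M in auto)
    also have "\<dots> = transpose_mat M *\<^sub>v (Omega_mat g *\<^sub>v (M *\<^sub>v vec ?n y))"
      by (rule assoc_mult_mat_vec[of _ ?n ?n _ ?n]) (use M in auto)
    finally show ?thesis ..
  qed
  finally show ?thesis .
qed

lemma mat_eq_bilinear:
  fixes A A' :: "'f::field mat"
  assumes A: "A \<in> carrier_mat n n" "A' \<in> carrier_mat n n"
    and eq: "\<And>i j. i < n \<Longrightarrow> j < n \<Longrightarrow> unit_vec n i \<bullet> (A *\<^sub>v unit_vec n j) = unit_vec n i \<bullet> (A' *\<^sub>v unit_vec n j)"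
  shows "A = A'"
proof (rule eq_matI)
  fix i j assume ij: "i < dim_row A'" "j < dim_col A'"
  have "unit_vec n i \<bullet> (X *\<^sub>v unit_vec n j) = X $$ (i, j)" if "X \<in> carrier_mat n n" for X :: "'f mat"
    using ij A that by simp
  thus "A $$ (i, j) = A' $$ (i, j)" using eq[of i j] ij A by simp
qed (use A in auto)

lemma GSp_iff:
  fixes M :: "'f::{field,finite} mat"
  assumes M: "M \<in> carrier_mat (2 * g) (2 * g)" and q: "of_nat q \<noteq> (0 :: 'f)"
  shows "M \<in> GSp q g \<longleftrightarrow> (\<forall>x\<in>supported (2 * g). \<forall>y\<in>supported (2 * g).
    symplectic g (mat_act (2 * g) M x) (mat_act (2 * g) M y) = of_nat q * symplectic g x y)"
proof
  let ?n = "2 * g" and ?q = "of_nat q :: 'f"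
  have c: "transpose_mat M * Omega_mat g * M \<in> carrier_mat ?n ?n" using M by auto
  have scaled: "vec ?n x \<bullet> ((?q \<cdot>\<^sub>m Omega_mat g) *\<^sub>v vec ?n y) = ?q * symplectic g x y" for x y :: "nat \<Rightarrow> 'f"
  proof -
    have "(?q \<cdot>\<^sub>m Omega_mat g) *\<^sub>v vec ?n y = ?q \<cdot>\<^sub>v (Omega_mat g *\<^sub>v vec ?n y)"
      by (rule eq_vecI) (simp_all add: carrier_matD[OF Omega_carrier])
    thus ?thesis unfolding symplectic_eq_Omega
      by (simp only:) (rule scalar_prod_smult_distrib[of _ ?n], auto intro: mult_mat_vec_carrier[OF Omega_carrier])
  qed
  {
    assume "M \<in> GSp q g"
    hence "transpose_mat M * Omega_mat g * M = ?q \<cdot>\<^sub>m Omega_mat g" by (simp add: GSp_def)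
    thus "\<forall>x\<in>supported ?n. \<forall>y\<in>supported ?n.
      symplectic g (mat_act ?n M x) (mat_act ?n M y) = ?q * symplectic g x y"
      by (simp add: symplectic_mat_act[OF M] scaled)
  next
    assume *: "\<forall>x\<in>supported ?n. \<forall>y\<in>supported ?n.
      symplectic g (mat_act ?n M x) (mat_act ?n M y) = ?q * symplectic g x y"
    have "transpose_mat M * Omega_mat g * M = ?q \<cdot>\<^sub>m Omega_mat g"
    proof (rule mat_eq_bilinear[OF c])
      fix i j assume "i < ?n" "j < ?n"
      thus "unit_vec ?n i \<bullet> (transpose_mat M * Omega_mat g * M *\<^sub>v unit_vec ?n j)
          = unit_vec ?n i \<bullet> (?q \<cdot>\<^sub>m Omega_mat g *\<^sub>v unit_vec ?n j)"
        using * symplectic_mat_act[OF M, of "basis_fun i" "basis_fun j"] scaled[of "basis_fun i" "basis_fun j"]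
        by (simp add: vec_basis_fun basis_fun_supported)
    qed simp
    \<comment> \<open>A kernel vector is orthogonal to the whole space because \<open>q\<close> is
      nonzero in the field, hence it vanishes by nondegeneracy.\<close>
    moreover have "invertible_mat M"
    proof -
      interpret alternating_form "fun_scale :: 'f \<Rightarrow> _" "symplectic g" by (rule alternating_form_symplectic)
      have "v = 0\<^sub>v ?n" if v: "v \<in> carrier_vec ?n" "M *\<^sub>v v = 0\<^sub>v ?n" for v
      proof -
        define x where "x = (\<lambda>i. if i < ?n then v $ i else 0)"
        have vx: "v = vec ?n x" using v by (intro eq_vecI) (auto simp: x_def)
        have x: "x \<in> supported ?n" by (simp add: x_def supported_def)
        have "mat_act ?n M x = 0" using v(2) by (auto simp: mat_act_def fun_eq_iff vx[symmetric])
        hence orth: "symplectic g x y = 0" if "y \<in> supported ?n" for y using *[rule_format, OF x that] q by simp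
        have "x = 0"
        proof (rule ccontr)
          assume "x \<noteq> 0"
          then obtain y where "y \<in> supported ?n" "symplectic g x y = 1"
            using hyperbolic_partner[OF nondegenerate_supported x] by metis
          thus False using orth by simp
        qed
        thus ?thesis by (simp add: vx zero_vec_def zero_fun_def)
      qed
      hence "det M \<noteq> 0" using det_0_iff_vec_prod_zero[OF M] by blast
      then obtain N where "N \<in> carrier_mat ?n ?n" "N * M = 1\<^sub>m ?n" "M * N = 1\<^sub>m ?n"
        using det_non_zero_imp_unit[OF M, of undefined] by (auto simp: Units_def ring_mat_simps)
      thus ?thesis using M by (auto simp: invertible_mat_def inverts_mat_def)
    qed
    ultimately show "M \<in> GSp q g" using M by (simp add: GSp_def)
  }
qed

section \<open>Matrices as similitudes\<close>

lemma mat_act_linear: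
  assumes M: "M \<in> carrier_mat n n"
  shows "mat_act n M (x + y) = mat_act n M x + mat_act n M y"
    "mat_act n M (fun_scale a x) = fun_scale a (mat_act n M x)"
proof -
  have "vec n (x + y) = vec n x + vec n y" "vec n (fun_scale a x) = a \<cdot>\<^sub>v vec n x"
    by (auto simp: fun_scale_def)
  thus "mat_act n M (x + y) = mat_act n M x + mat_act n M y"
    "mat_act n M (fun_scale a x) = fun_scale a (mat_act n M x)"
    using M mult_add_distrib_mat_vec[OF M, of "vec n x" "vec n y"] mult_mat_vec[OF M, of "vec n x" a]
    by (auto simp: mat_act_def fun_scale_def fun_eq_iff)
qed

lemma mat_act_basis:
  assumes "M \<in> carrier_mat n n" "i < n" "j < n"
  shows "mat_act n M (basis_fun j) i = M $$ (i, j)"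
  using assms by (simp add: mat_act_def vec_basis_fun)

text \<open>The inverse map collects the images of the basis functions as columns.\<close>

lemma GSp_bij_similitudes:
  assumes q: "of_nat q \<noteq> (0 :: 'f::{field,finite})"
  shows "bij_betw (\<lambda>M. restrict (mat_act (2 * g) M) (supported (2 * g))) (GSp q g :: 'f mat set)
    (alternating_form.similitudes fun_scale (symplectic g) (supported (2 * g)) (of_nat q))"
proof -
  interpret alternating_form "fun_scale :: 'f \<Rightarrow> _" "symplectic g" by (rule alternating_form_symplectic)
  let ?n = "2 * g" and ?W = "supported (2 * g) :: (nat \<Rightarrow> 'f) set"
  let ?inv = "\<lambda>f. mat ?n ?n (\<lambda>(i, j). f (basis_fun j) i) :: 'f mat"
  have act_in: "mat_act ?n M x \<in> ?W" for M x by (simp add: mat_act_def supported_def)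
  have act_inv: "mat_act ?n (?inv f) x = f x" if f: "f \<in> similitudes ?W (of_nat q)" and x: "x \<in> ?W" for f x
  proof (rule ext)
    fix i
    \<comment> \<open>Linearity of \<open>f\<close> holds only on \<open>?W\<close>, so the
      induction also records that the partial sums stay there.\<close>
    have "f (\<Sum>j\<in>A. fun_scale (x j) (basis_fun j)) = (\<Sum>j\<in>A. fun_scale (x j) (f (basis_fun j)))
      \<and> (\<Sum>j\<in>A. fun_scale (x j) (basis_fun j)) \<in> ?W" if "A \<subseteq> {..<?n}" "finite A" for A
      using that(2,1)
    proof (induction A rule: finite_induct)
      case empty
      show ?case using similitudesD(3)[OF f x, of 0] subspace_0[OF subspace_supported, of ?n]
        by (simp add: zero_fun_def)
    next
      case (insert j A)
      have b: "basis_fun j \<in> ?W" using insert.prems by (simp add: basis_fun_supported)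
      have xb: "fun_scale (x j) (basis_fun j) \<in> ?W" by (rule subspace_scale[OF subspace_supported b])
      have IH: "f (\<Sum>j\<in>A. fun_scale (x j) (basis_fun j)) = (\<Sum>j\<in>A. fun_scale (x j) (f (basis_fun j)))"
        "(\<Sum>j\<in>A. fun_scale (x j) (basis_fun j)) \<in> ?W"
        using insert.IH insert.prems by blast+
      show ?case
        unfolding sum.insert[OF insert.hyps] similitudesD(2)[OF f xb IH(2)] similitudesD(3)[OF f b] IH(1)
        by (rule conjI[OF refl subspace_add[OF subspace_supported xb IH(2)]])
    qed
    from this[of "{..<?n}"] have "f x = (\<Sum>j<?n. fun_scale (x j) (f (basis_fun j)))"
      using supported_expand[OF x] by simp
    hence fx: "f x i = (\<Sum>j<?n. x j * f (basis_fun j) i)" by (simp add: sum_fun_apply fun_scale_def)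
    show "mat_act ?n (?inv f) x i = f x i"
    proof (cases "i < ?n")
      case True
      thus ?thesis by (simp add: fx mat_act_def scalar_prod_def atLeast0LessThan mult.commute)
    next
      case False
      thus ?thesis using similitudesD(1)[OF f x] by (simp add: mat_act_def supported_def)
    qed
  qed
  show ?thesis
  proof (rule bij_betw_byWitness[where f' = ?inv])
    show "\<forall>M\<in>GSp q g. ?inv (restrict (mat_act ?n M) ?W) = M"
    proof
      fix M :: "'f mat" assume "M \<in> GSp q g"
      hence "M \<in> carrier_mat ?n ?n" by (simp add: GSp_def)
      thus "?inv (restrict (mat_act ?n M) ?W) = M"
        by (intro eq_matI) (auto simp: basis_fun_supported mat_act_basis)
    qed
    show "\<forall>f\<in>similitudes ?W (of_nat q). restrict (mat_act ?n (?inv f)) ?W = f"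
      using act_inv by (auto intro!: extensionalityI[of _ ?W] dest: similitudesD(6))
    show "(\<lambda>M. restrict (mat_act ?n M) ?W) ` GSp q g \<subseteq> similitudes ?W (of_nat q)"
    proof (rule image_subsetI)
      fix M :: "'f mat" assume G: "M \<in> GSp q g"
      hence M: "M \<in> carrier_mat ?n ?n" by (simp add: GSp_def)
      show "restrict (mat_act ?n M) ?W \<in> similitudes ?W (of_nat q)"
        using G unfolding GSp_iff[OF M q]
        by (intro similitudes_restrictI subspace_supported) (auto simp: act_in mat_act_linear[OF M])
    qed
    show "?inv ` similitudes ?W (of_nat q) \<subseteq> GSp q g"
    proof (rule image_subsetI)
      fix f assume f: "f \<in> similitudes ?W (of_nat q)"
      have M: "?inv f \<in> carrier_mat ?n ?n" by simp
      show "?inv f \<in> GSp q g"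
        unfolding GSp_iff[OF M q] using act_inv[OF f] similitudesD(4)[OF f] by simp
    qed
  qed
qed

lemma eigenvalue_one_iff:
  fixes M :: "'f::{field,finite} mat"
  assumes M: "M \<in> carrier_mat n n"
  shows "eigenvalue M 1 \<longleftrightarrow> {x \<in> supported n. mat_act n M x = x} \<noteq> {0}"
proof
  assume "eigenvalue M 1"
  then obtain v where v: "v \<in> carrier_vec n" "v \<noteq> 0\<^sub>v n" "M *\<^sub>v v = v"
    using M by (auto simp: eigenvalue_def eigenvector_def)
  define x where "x = (\<lambda>i. if i < n then v $ i else 0)"
  have vx: "vec n x = v" using v by (intro eq_vecI) (auto simp: x_def)
  have "x \<noteq> 0" using v(2) vx by (auto simp: zero_vec_def zero_fun_def)
  moreover have "mat_act n M x = x" using v(3) by (auto simp: mat_act_def vx fun_eq_iff) (auto simp: x_def)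
  moreover have "x \<in> supported n" by (simp add: supported_def x_def)
  ultimately show "{x \<in> supported n. mat_act n M x = x} \<noteq> {0}" by blast
next
  assume "{x \<in> supported n. mat_act n M x = x} \<noteq> {0}"
  moreover have "mat_act n M 0 = 0"
    using mat_act_linear(2)[OF M, of 0 0] by (simp add: fun_scale_def zero_fun_def)
  moreover have "(0 :: nat \<Rightarrow> 'f) \<in> supported n" by (simp add: supported_def)
  ultimately obtain x where x: "x \<in> supported n" "mat_act n M x = x" "x \<noteq> 0" by blast
  then obtain i where i: "x i \<noteq> 0" by (auto simp: fun_eq_iff)
  hence "i < n" using x(1) by (auto simp: supported_def not_le[symmetric])
  hence "vec n x \<noteq> 0\<^sub>v n" using i by (metis index_vec index_zero_vec(1))
  moreover have "M *\<^sub>v vec n x = vec n x" using vec_mat_act[OF M, of x] x(2) by simp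
  ultimately show "eigenvalue M 1"
    using M by (auto simp: eigenvalue_def eigenvector_def intro!: exI[of _ "vec n x"])
qed

section \<open>The proportion in closed form\<close>

lemma bij_betw_filter:
  assumes h: "bij_betw h A C" and PQ: "\<And>x. x \<in> A \<Longrightarrow> P x \<longleftrightarrow> Q (h x)"
  shows "bij_betw h {x \<in> A. P x} {y \<in> C. Q y}"
proof -
  have "h ` {x \<in> A. P x} = {y \<in> C. Q y}"
    using PQ bij_betw_imp_surj_on[OF h] by (auto simp: image_iff)
  moreover have "inj_on h {x \<in> A. P x}"
    by (rule inj_on_subset[OF bij_betw_imp_inj_on[OF h]]) auto
  ultimately show ?thesis by (simp add: bij_betw_def)
qed

text \<open>Matrices without eigenvalue 1 correspond to similitudes with trivial fixed space, whose
  number is \<open>qpoch_sum\<close> at 1. The polynomials satisfy the recursion of the means and so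
  give its value.\<close>

lemma eigenvalue_one_proportion_eq:
  fixes q g :: nat
  defines "l \<equiv> CARD('l::prime_card)"
  assumes q: "\<not> l dvd q"
  shows "eigenvalue_one_proportion TYPE('l) q g
    = 1 - (if [q = 1] (mod l) then isometry_poly (1 / real l) g 1 else multiplier_poly (1 / real l) g 1)"
proof -
  interpret alternating_form "fun_scale :: 'l mod_ring \<Rightarrow> _" "symplectic g" by (rule alternating_form_symplectic)
  let ?n = "2 * g" and ?W = "supported (2 * g) :: (nat \<Rightarrow> 'l mod_ring) set"
  define k where "k = (of_nat q :: 'l mod_ring)"
  define H where "H = (if k = 1 then isometry_poly (1 / real l) else multiplier_poly (1 / real l))"
  have k: "k \<noteq> 0" using q by (simp add: k_def of_nat_eq_0_iff_char_dvd l_def)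
  have k1: "k = 1 \<longleftrightarrow> [q = 1] (mod l)"
    using of_nat_eq_iff_cong_CHAR[of q 1, where ?'a = "'l mod_ring"] by (simp add: k_def l_def)
  have card: "CARD('l mod_ring) = l" by (simp add: l_def)
  have l: "real l > 1" using card_field_gt_1 card by simp
  have count: "card (similitudes ?W k) > 0 \<and> qpoch_sum ?W k 1 = real (card (similitudes ?W k)) * H g 1"
  proof (rule qpoch_sum_eq[OF k])
    show "H 0 s = 1" "H j 0 = 1" for j s
      by (simp_all add: H_def isometry_poly_at_0 multiplier_poly_at_0)
        (simp_all add: isometry_poly_def multiplier_poly_def isometry_term_def)
    show "isCont (H j) 0" for j
      unfolding H_def isometry_poly_def multiplier_poly_def isometry_term_def by (auto intro!: continuous_intros)
    show "H (Suc j) (real CARD('l mod_ring) * s) - H (Suc j) s =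
      - s * (H j s - (if k = 1 then s * H j (real CARD('l mod_ring) * s) else 0))" for j s
      unfolding H_def card using isometry_poly_rec[OF l, of j s] multiplier_poly_rec[OF l, of j s] by simp
  qed (simp_all add: nondegenerate_supported card_supported)
  have G: "bij_betw (\<lambda>M. restrict (mat_act ?n M) ?W) (GSp q g :: 'l mod_ring mat set) (similitudes ?W k)"
    unfolding k_def by (rule GSp_bij_similitudes) (use k in \<open>simp add: k_def\<close>)
  have fixed_eq: "\<not> eigenvalue M 1 \<longleftrightarrow> fixed ?W (restrict (mat_act ?n M) ?W) = {0}" if "M \<in> GSp q g" for M
  proof -
    have "M \<in> carrier_mat ?n ?n" using that by (simp add: GSp_def)
    moreover have "fixed ?W (restrict (mat_act ?n M) ?W) = {x \<in> ?W. mat_act ?n M x = x}"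
      by (auto simp: fixed_def)
    ultimately show ?thesis by (simp only: eigenvalue_one_iff) simp
  qed
  have "bij_betw (\<lambda>M. restrict (mat_act ?n M) ?W) {M \<in> (GSp q g :: 'l mod_ring mat set). \<not> eigenvalue M 1}
      {f \<in> similitudes ?W k. fixed ?W f = {0}}"
    by (rule bij_betw_filter[OF G, where P = "\<lambda>M. \<not> eigenvalue M 1" and Q = "\<lambda>f. fixed ?W f = {0}"])
      (rule fixed_eq)
  hence none: "card {M \<in> (GSp q g :: 'l mod_ring mat set). \<not> eigenvalue M 1} = card {f \<in> similitudes ?W k. fixed ?W f = {0}}"
    by (rule bij_betw_same_card)
  have all: "card (GSp q g :: 'l mod_ring mat set) = card (similitudes ?W k)"
    by (rule bij_betw_same_card[OF G])
  have fin: "finite (GSp q g :: 'l mod_ring mat set)"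
    using count all by (intro card_ge_0_finite) simp
  have "card {M \<in> (GSp q g :: 'l mod_ring mat set). eigenvalue M 1} + card {M \<in> (GSp q g :: 'l mod_ring mat set). \<not> eigenvalue M 1}
      = card (GSp q g :: 'l mod_ring mat set)"
    using fin by (subst card_Un_disjoint[symmetric]) (auto intro!: arg_cong[where f = card])
  hence "real (card {M \<in> (GSp q g :: 'l mod_ring mat set). eigenvalue M 1})
      = real (card (similitudes ?W k)) - qpoch_sum ?W k 1"
    unfolding all none qpoch_sum_one[OF nondegenerate_supported] by linarith
  hence "eigenvalue_one_proportion TYPE('l) q g = 1 - H g 1"
    using count by (simp add: eigenvalue_one_proportion_def all field_simps)
  thus ?thesis by (auto simp: H_def k1)
qed

theorem theorem5p4:
  fixes q :: nat
  assumes "primepow q"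
    and "\<not> CARD('l::prime_card) dvd q"
  shows "(\<lambda>g. eigenvalue_one_proportion TYPE('l) q g) \<longlonglongrightarrow>
           (if CARD('l) dvd q - 1
            then 1 - (\<Prod>j. inverse (1 + 1 / real CARD('l) ^ Suc j))
            else 1 - (\<Prod>j. 1 - 1 / real CARD('l) ^ Suc j))
       \<and> (\<lambda>g. eigenvalue_one_error TYPE('l) q g) \<longlonglongrightarrow> 0
       \<and> (\<forall>g. (- 1) ^ g * eigenvalue_one_error TYPE('l) q g > 0)"
proof -
  define l where "l = CARD('l)"
  define u where "u = 1 / real l"
  \<comment> \<open>This base takes the place of the parameter \<open>v\<close> in
    \<open>euler_product\<close>: \<open>u\<^sup>2\<close> gives the product over odd powers,
    \<open>u\<close> the product over all powers.\<close>
  define w where "w = (if l dvd q - 1 then u\<^sup>2 else u)"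
  define L where "L = (if l dvd q - 1 then 1 - (\<Prod>j. inverse (1 + 1 / real l ^ Suc j))
    else 1 - (\<Prod>j. 1 - 1 / real l ^ Suc j))"
  have q: "q > 1" using primepow_gt_Suc_0[OF assms(1)] by simp
  have l2: "l \<ge> 2" using prime_card[where 'a = 'l] by (simp add: l_def prime_ge_2_nat)
  have u: "0 < u" "u \<le> 1 / 2" using l2 by (auto simp: u_def field_simps)
  have pow: "1 / real l ^ j = u ^ j" for j by (simp add: u_def power_divide)
  have cong: "[q = 1] (mod l) \<longleftrightarrow> l dvd q - 1"
    using cong_altdef_nat[of 1 q l] q by (simp add: cong_sym_eq)
  \<comment> \<open>If \<open>l = 2\<close>, then \<open>q\<close> is odd and \<open>l\<close>
    divides \<open>q - 1\<close>. So \<open>l > 2\<close> here, which the condition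
    \<open>u + u < 1\<close> of \<open>euler_product\<close> demands.\<close>
  have u3: "u < 1 / 2" if "\<not> l dvd q - 1"
  proof -
    have "l \<noteq> 2" using that assms(2) q unfolding l_def[symmetric] by (auto simp: even_diff_nat)
    hence "l > 2" using l2 by simp
    thus ?thesis by (simp add: u_def field_simps)
  qed
  have u2: "u\<^sup>2 \<le> 1 / 4" using power_mono[of u "1 / 2" 2] u by (simp add: power_divide)
  interpret euler_product u w
    by unfold_locales (use u u2 u3 in \<open>auto simp: w_def\<close>)
  have proportion: "eigenvalue_one_proportion TYPE('l) q g = 1 - (\<Sum>n\<le>g. c n)" for g
    using eigenvalue_one_proportion_eq[where 'l = 'l, OF assms(2), of g] u
    unfolding l_def[symmetric] cong u_def[symmetric]
    by (auto simp: w_def isometry_poly_def multiplier_poly_def isometry_term_one)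
  have limit: "L = 1 - suminf c"
    unfolding L_def pow using prodinf_inverse_one_plus[OF u] prodinf_one_minus[OF u(1)] u3 by (auto simp: w_def)
  have error: "eigenvalue_one_error TYPE('l) q g = (\<Sum>n\<le>g. c n) - suminf c" for g
    using limit proportion[of g] unfolding eigenvalue_one_error_def l_def[symmetric] L_def by (auto split: if_splits)
  have "(\<lambda>g. eigenvalue_one_proportion TYPE('l) q g) \<longlonglongrightarrow> L"
    unfolding proportion limit by (intro tendsto_intros partial_sums_tendsto)
  moreover have "(\<lambda>g. eigenvalue_one_error TYPE('l) q g) \<longlonglongrightarrow> 0"
    unfolding error using tendsto_diff[OF partial_sums_tendsto tendsto_const[of "suminf c"]] by simp
  moreover have "\<forall>g. (- 1) ^ g * eigenvalue_one_error TYPE('l) q g > 0"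
    unfolding error using partial_sums_alternate by blast
  ultimately show ?thesis unfolding L_def l_def by blast
qed

end
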